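(* Let $\mathcal{A}$ denote the family of planar convex sets. Then we have (i) $s(n,\mathcal{A}) = \lceil n/2\rceil$; and (ii) $$\frac{n}{2\log n}\;\le\; s'(n,\mathcal{A})\;\le\; \frac{20\,n\log\log n}{\log n}.$$
   Context: All logarithms are to base 2. A set $S$ separates two elements $x$ and $y$ if exactly one of $x$ and $y$ is in $S$. Given an underlying set $X$, a family $\mathcal{F}$ of subsets of $X$ is called separating if for any $x,y\in X$ with $x\neq y$ there exists $F\in\mathcal{F}$ that separates $x$ and $y$. Let $X$ be a set of $n$ points in the plane and let $\mathcal{A}$ be a family of planar sets. $s(X,\mathcal{A})$ denotes the size of the smallest subfamily $\mathcal{A}'\subseteq\mathcal{A}$ with the property that the family $\{A\cap X : A\in\mathcal{A}'\}$ is separating (as a family of subsets of $X$); if there is no such subfamily, $s(X,\mathcal{A})=\infty$. $s(n,\mathcal{A})$ is the maximum of $s(X,\mathcal{A})$ over all $n$-element point sets $X$ in the plane. $s'(n,\mathcal{A})$ is the maximum of $s(X,\mathcal{A})$ over all $n$-element point sets $X$ in the plane in general position, where general position means that no three points of $X$ lie on a line.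
   Formalization: The range of n is made explicit: (i) and the lower bound in (ii) are for n ≥ 2 (at n = 1, s = 0 but ⌈1/2⌉ = 1, and log 1 = 0); the upper bound in (ii) is for n ≥ 3 (at n = 2 its right side is 0 while s'(2) = 1). *)

theory Defs
  imports "HOL-Analysis.Analysis" "HOL-Library.Extended_Nat"
begin

definition separates :: "'a set \<Rightarrow> 'a \<Rightarrow> 'a \<Rightarrow> bool" where
  "separates S x y \<longleftrightarrow> (x \<in> S) \<noteq> (y \<in> S)"

definition separating :: "'a set \<Rightarrow> 'a set set \<Rightarrow> bool" where
  "separating X F \<longleftrightarrow> F \<subseteq> Pow X \<and> (\<forall>x\<in>X. \<forall>y\<in>X. x \<noteq> y \<longrightarrow> (\<exists>S\<in>F. separates S x y))"

(* The infimum is a minimum whenever some finite subfamily qualifies, and Inf {} is the value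
   infinity otherwise. Infinite subfamilies have size infinity and need not be listed. *)
definition sep_num :: "'a set \<Rightarrow> 'a set set \<Rightarrow> enat" where
  "sep_num X \<A> = Inf {enat (card \<B>) | \<B>. \<B> \<subseteq> \<A> \<and> finite \<B> \<and> separating X ((\<lambda>A. A \<inter> X) ` \<B>)}"

definition general_position :: "(real ^ 2) set \<Rightarrow> bool" where
  "general_position X \<longleftrightarrow>
     (\<forall>x\<in>X. \<forall>y\<in>X. \<forall>z\<in>X. x \<noteq> y \<and> y \<noteq> z \<and> x \<noteq> z \<longrightarrow> \<not> collinear {x, y, z})"

(* In the two definitions below the supremum is taken over a nonempty set of extended natural
   numbers, so it is attained whenever it is finite. *)
definition max_sep_num :: "nat \<Rightarrow> (real ^ 2) set set \<Rightarrow> enat" where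
  "max_sep_num n \<A> = (SUP X \<in> {X. finite X \<and> card X = n}. sep_num X \<A>)"

definition max_sep_num_gp :: "nat \<Rightarrow> (real ^ 2) set set \<Rightarrow> enat" where
  "max_sep_num_gp n \<A> =
     (SUP X \<in> {X. finite X \<and> card X = n \<and> general_position X}. sep_num X \<A>)"

definition planar_convex_sets :: "(real ^ 2) set set" where
  "planar_convex_sets = {C. convex C}"

end

theory Submission
  imports Defs
begin

text \<open>
  (i) Order the points by a linear functional that is injective on \<open>X\<close>. The \<open>\<lceil>n/2\<rceil>\<close> strips
  containing the points of rank \<open>i, \<dots>, i + \<lceil>n/2\<rceil> - 1\<close> separate \<open>X\<close>. Conversely, if the points are
  on a line, then in their cyclic order a convex set separates at most two of the \<open>n\<close> pairs of
  neighbours.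

  (ii), upper bound: by the Erdos--Szekeres theorem \<open>X\<close> can be partitioned greedily into vertex sets
  of convex polygons with about \<open>(log n)/4\<close> vertices each, up to about \<open>\<surd>n\<close> points. As vertices
  may be deleted from a convex polygon without destroying convexity, \<open>2 + log k\<close> convex sets separate
  the \<open>k\<close> vertices of one polygon from each other and from all other points.

  (ii), lower bound: take an Erdos--Szekeres set of \<open>2^K\<close> points without \<open>K + 3\<close> points in
  convex position and replace its points by clusters of three points in general position. The
  clusters cut by a convex set belong to points in convex position, and each cluster has to
  be cut twice. (Clusters of two points would lose too much when \<open>n\<close> is not twice a power of two.)
\<close>

section \<open>Points in arbitrary position\<close>

lemma sep_num_le:
  assumes "finite F" "\<And>A. A \<in> F \<Longrightarrow> convex A"
    and "\<And>x y. x \<in> X \<Longrightarrow> y \<in> X \<Longrightarrow> x \<noteq> y \<Longrightarrow> \<exists>A\<in>F. separates A x y"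
  shows "sep_num X planar_convex_sets \<le> enat (card F)"
  unfolding sep_num_def
proof (rule Inf_lower, rule CollectI, intro exI[of _ F] conjI refl)
  show "F \<subseteq> planar_convex_sets"
    using assms(2) by (auto simp: planar_convex_sets_def)
  show "separating X ((\<lambda>A. A \<inter> X) ` F)"
    unfolding separating_def
  proof (intro conjI ballI impI)
    fix x y assume xy: "x \<in> X" "y \<in> X" "x \<noteq> y"
    then obtain A where "A \<in> F" "separates A x y" using assms(3) by blast
    then show "\<exists>S\<in>(\<lambda>A. A \<inter> X) ` F. separates S x y"
      using xy by (intro bexI[of _ "A \<inter> X"]) (auto simp: separates_def)
  qed auto
qed (rule assms(1))

lemma le_sep_num:
  assumes "\<And>F. finite F \<Longrightarrow> (\<And>A. A \<in> F \<Longrightarrow> convex A) \<Longrightarrow>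
      (\<And>x y. x \<in> X \<Longrightarrow> y \<in> X \<Longrightarrow> x \<noteq> y \<Longrightarrow> \<exists>A\<in>F. separates A x y) \<Longrightarrow> m \<le> card F"
  shows "enat m \<le> sep_num X planar_convex_sets"
  unfolding sep_num_def
proof (rule Inf_greatest)
  fix z assume "z \<in> {enat (card \<B>) |\<B>. \<B> \<subseteq> planar_convex_sets \<and> finite \<B> \<and>
      separating X ((\<lambda>A. A \<inter> X) ` \<B>)}"
  then obtain F where F: "F \<subseteq> planar_convex_sets" "finite F" "z = enat (card F)"
    "separating X ((\<lambda>A. A \<inter> X) ` F)" by auto
  have "m \<le> card F"
  proof (rule assms)
    fix x y assume "x \<in> X" "y \<in> X" "x \<noteq> y"
    then obtain A where "A \<in> F" "separates (A \<inter> X) x y"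
      using F(4) unfolding separating_def by blast
    then show "\<exists>A\<in>F. separates A x y"
      using \<open>x \<in> X\<close> \<open>y \<in> X\<close> by (auto simp: separates_def)
  qed (use F in \<open>auto simp: planar_convex_sets_def\<close>)
  then show "enat m \<le> z" by (simp add: F)
qed

text \<open>This functional serves as the abscissa, so that no set has to be rotated: points may
  share their first coordinate, but for all but finitely many \<open>t\<close> it is injective on a
  given finite set.\<close>

definition key :: "real \<Rightarrow> real ^ 2 \<Rightarrow> real" where
  "key t p = p $ 1 + t * p $ 2"

lemma key_lin: "key t (u *\<^sub>R p + v *\<^sub>R q) = u * key t p + v * key t q"
  by (simp add: key_def algebra_simps)

text \<open>Two points with different second coordinates get the same key for exactly one
  \<open>t\<close>, namely the quotient collected in \<open>B\<close>. If the second coordinates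
  agree, equal keys force equal first coordinates.\<close>

lemma ex_inj_key:
  assumes "finite X"
  obtains t where "inj_on (key t) X"
proof -
  define B where "B = (\<lambda>(p, q). (p $ 1 - q $ 1) / (q $ 2 - p $ 2)) ` (X \<times> X)"
  have "finite B" using assms by (simp add: B_def)
  then obtain t where t: "t \<notin> B" using ex_new_if_finite infinite_UNIV_char_0 by blast
  have "inj_on (key t) X"
  proof (rule inj_onI)
    fix p q assume pq: "p \<in> X" "q \<in> X" and e: "key t p = key t q"
    have "(p $ 1 - q $ 1) / (q $ 2 - p $ 2) \<in> B"
      unfolding B_def using pq by (intro image_eqI[of _ _ "(p, q)"]) auto
    then have "t \<noteq> (p $ 1 - q $ 1) / (q $ 2 - p $ 2)" using t by metis
    moreover have "t * (q $ 2 - p $ 2) = p $ 1 - q $ 1"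
      using e by (simp add: key_def algebra_simps)
    ultimately have "q $ 2 = p $ 2"
      by (metis diff_self eq_divide_eq right_minus_eq)
    then show "p = q" using e by (simp add: key_def vec_eq_iff forall_2)
  qed
  then show ?thesis using that by blast
qed

section \<open>Strips by rank: the upper bound in (i)\<close>

lemma sep_num_le_half:
  assumes "finite X" "card X = n"
  shows "sep_num X planar_convex_sets \<le> enat ((n + 1) div 2)"
proof -
  define k where "k = (n + 1) div 2"
  obtain t where inj: "inj_on (key t) X" using ex_inj_key[OF assms(1)] .
  define r where "r p = card {y \<in> X. key t y < key t p}" for p
  have r_mono: "r p \<le> r q" if "key t p \<le> key t q" for p q
    unfolding r_def using assms(1) that by (intro card_mono) auto
  have r_strict: "r p < r q" if "key t p < key t q" "p \<in> X" for p q
  proof -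
    have "{y \<in> X. key t y < key t p} \<subset> {y \<in> X. key t y < key t q}"
    proof
      show "{y \<in> X. key t y < key t p} \<subseteq> {y \<in> X. key t y < key t q}"
        using that by auto
      show "{y \<in> X. key t y < key t p} \<noteq> {y \<in> X. key t y < key t q}"
        using that by blast
    qed
    then show ?thesis unfolding r_def using assms(1) by (intro psubset_card_mono) simp_all
  qed
  have r_less: "r p < n" if "p \<in> X" for p
  proof -
    have "{y \<in> X. key t y < key t p} \<subset> X" using that by blast
    then show ?thesis unfolding r_def using assms by (simp add: psubset_card_mono flip: assms(2))
  qed
  define A where "A i = {p. i \<le> r p \<and> r p < i + k}" for i
  have conv: "convex (A i)" for i
  proof (rule convexI)
    fix p q :: "real ^ 2" and u v :: real
    assume p: "p \<in> A i" and q: "q \<in> A i" and uv: "0 \<le> u" "0 \<le> v" "u + v = 1"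
    let ?z = "u *\<^sub>R p + v *\<^sub>R q"
    have "key t ?z \<le> max (key t p) (key t q)"
      unfolding key_lin using uv by (intro convex_bound_le) auto
    moreover have "u * - key t p + v * - key t q \<le> - min (key t p) (key t q)"
      using uv by (intro convex_bound_le) auto
    ultimately have "min (key t p) (key t q) \<le> key t ?z \<and> key t ?z \<le> max (key t p) (key t q)"
      by (simp add: key_lin)
    then have "min (r p) (r q) \<le> r ?z \<and> r ?z \<le> max (r p) (r q)"
      using r_mono[of p ?z] r_mono[of q ?z] r_mono[of ?z p] r_mono[of ?z q] by linarith
    then show "?z \<in> A i" using p q by (auto simp: A_def)
  qed
  have sep: "\<exists>B\<in>A ` {..<k}. separates B x y" if "x \<in> X" "y \<in> X" "r x < r y" for x y
  proof -
    have n: "r y < 2 * k" using r_less[OF that(2)] by (simp add: k_def)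
    \<comment> \<open>All ranks are below \<open>2 * k\<close>. Two small ranks are told apart by
      the strip starting just after \<open>x\<close>, two large ones by the strip ending at
      \<open>x\<close>, and a small rank from a large one by the first strip. In each case the index
      of the strip stays below \<open>k\<close>.\<close>
    consider "r y < k" | "r x < k" "k \<le> r y" | "k \<le> r x" by linarith
    then show ?thesis
    proof cases
      case 1
      then have "separates (A (Suc (r x))) x y" using that n by (auto simp: separates_def A_def)
      then show ?thesis using 1 that by auto
    next
      case 2
      then have "separates (A 0) x y" using that n by (auto simp: separates_def A_def)
      then show ?thesis using 2 by auto
    next
      case 3
      then have "separates (A (Suc (r x) - k)) x y" using that n by (auto simp: separates_def A_def)
      then show ?thesis using 3 n that by auto
    qed
  qed
  have "sep_num X planar_convex_sets \<le> enat (card (A ` {..<k}))"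
  proof (rule sep_num_le)
    fix x y assume xy: "x \<in> X" "y \<in> X" "x \<noteq> y"
    then have "key t x \<noteq> key t y" using inj by (auto dest: inj_onD)
    then have "r x < r y \<or> r y < r x" using r_strict xy by (metis linorder_neqE)
    then show "\<exists>B\<in>A ` {..<k}. separates B x y"
      using sep[of x y] sep[of y x] xy by (auto simp: separates_def)
  qed (use conv in auto)
  also have "\<dots> \<le> enat k" using card_image_le[of "{..<k}" A] by simp
  finally show ?thesis by (simp add: k_def)
qed

section \<open>Collinear points: the lower bound in (i)\<close>

lemma card_le_1I:
  assumes "\<And>x y. x \<in> S \<Longrightarrow> y \<in> S \<Longrightarrow> x = y"
  shows "card S \<le> 1"
proof (cases "finite S")
  case True
  then show ?thesis using assms by (simp add: card_le_Suc0_iff_eq)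
qed simp

lemma line_sep_num:
  assumes n: "n \<ge> 2"
  obtains X where "finite X" "card X = n" "enat ((n + 1) div 2) \<le> sep_num X planar_convex_sets"
proof -
  define p :: "nat \<Rightarrow> real ^ 2" where "p i = vector [real i, 0]" for i
  have inj: "inj p"
    by (auto simp: inj_def p_def vec_eq_iff forall_2)
  define X where "X = p ` {..<n}"
  \<comment> \<open>The cyclic successor. The pair closing the cycle makes \<open>n\<close> pairs
    out of \<open>n - 1\<close>; without it the bound would lose one for odd
    \<open>n\<close>.\<close>
  define s where "s g = (if Suc g = n then 0 else Suc g)" for g
  have "enat ((n + 1) div 2) \<le> sep_num X planar_convex_sets"
  proof (rule le_sep_num)
    fix F assume fin: "finite F" and cv: "\<And>A. A \<in> F \<Longrightarrow> convex A"
      and sep: "\<And>x y. x \<in> X \<Longrightarrow> y \<in> X \<Longrightarrow> x \<noteq> y \<Longrightarrow> \<exists>A\<in>F. separates A x y"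
    define c where "c A = {g. g < n \<and> separates A (p g) (p (s g))}" for A
    have c2: "card (c A) \<le> 2" if "A \<in> F" for A
    proof -
      have ivl: "p j \<in> A" if "p i \<in> A" "p l \<in> A" "i \<le> j" "j \<le> l" for i j l
      proof (cases "i = l")
        case False
        then have "real i < real l" using that by simp
        define v where "v = (real j - real i) / (real l - real i)"
        have v: "0 \<le> v" "v \<le> 1" "v * (real l - real i) = real j - real i"
          using that False by (auto simp: v_def divide_simps)
        have "(1 - v) *\<^sub>R p i + v *\<^sub>R p l \<in> A"
          using v that by (intro convexD[OF cv[OF \<open>A \<in> F\<close>]]) auto
        moreover have "(1 - v) *\<^sub>R p i + v *\<^sub>R p l = p j"
          using v(3) by (simp add: p_def vec_eq_iff forall_2 algebra_simps)
        ultimately show ?thesis by simp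
      qed (use that in auto)
      \<comment> \<open>\<open>c1\<close> collects the places where the cyclic walk leaves
        \<open>A\<close>, \<open>c2\<close> those where it enters \<open>A\<close>. As
        \<open>A\<close> meets the line in an interval, each happens at most once.\<close>
      define c1 where "c1 = {g. g < n \<and> p g \<in> A \<and> p (s g) \<notin> A}"
      define c2 where "c2 = {g. g < n \<and> p g \<notin> A \<and> p (s g) \<in> A}"
      have 1: False if "g \<in> c1" "h \<in> c1" "g < h" for g h
        using that ivl[of g h "Suc g"] by (auto simp: c1_def s_def split: if_splits)
      \<comment> \<open>Entries are compared by the points entered: the pair closing the cycle
        enters at index 0 although \<open>g\<close> itself is \<open>n - 1\<close>.\<close>
      have 2: False if "g \<in> c2" "h \<in> c2" "s g < s h" for g h
        using that ivl[of "s g" "s h" h] by (auto simp: c2_def s_def split: if_splits)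
      have s_eq: "g = h" if "s g = s h" "g < n" "h < n" for g h
        using that by (auto simp: s_def split: if_splits)
      have "card c1 \<le> 1"
      proof (rule card_le_1I)
        show "g = h" if "g \<in> c1" "h \<in> c1" for g h
          using 1[of g h] 1[of h g] that by (cases g h rule: linorder_cases) auto
      qed
      moreover have "card c2 \<le> 1"
      proof (rule card_le_1I)
        fix g h assume gh: "g \<in> c2" "h \<in> c2"
        then have "s g = s h"
          using 2[of g h] 2[of h g] by (cases "s g" "s h" rule: linorder_cases) auto
        then show "g = h" using s_eq gh by (auto simp: c2_def)
      qed
      moreover have "c A = c1 \<union> c2" by (auto simp: c_def c1_def c2_def separates_def)
      ultimately show ?thesis using card_Un_le[of c1 c2] by simp
    qed
    have "{..<n} \<subseteq> (\<Union>A\<in>F. c A)"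
    proof
      fix g assume "g \<in> {..<n}"
      then have "p g \<in> X" "p (s g) \<in> X" "p g \<noteq> p (s g)"
        using n inj by (auto simp: X_def s_def inj_eq)
      then obtain A where "A \<in> F" "separates A (p g) (p (s g))" using sep by blast
      then show "g \<in> (\<Union>A\<in>F. c A)" using \<open>g \<in> {..<n}\<close> by (auto simp: c_def)
    qed
    then have "n \<le> card (\<Union>A\<in>F. c A)"
      using card_mono[of "\<Union>A\<in>F. c A" "{..<n}"] fin by (simp add: c_def)
    also have "\<dots> \<le> (\<Sum>A\<in>F. card (c A))" using card_UN_le[OF fin] .
    also have "\<dots> \<le> (\<Sum>A\<in>F. 2)" by (rule sum_mono) (rule c2)
    finally show "(n + 1) div 2 \<le> card F" by simp
  qed
  moreover have "finite X" "card X = n"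
    using inj by (auto simp: X_def card_image inj_on_subset)
  ultimately show ?thesis using that by blast
qed

lemma max_sep_num_eq:
  assumes "n \<ge> 2"
  shows "max_sep_num n planar_convex_sets = enat ((n + 1) div 2)"
proof (rule antisym)
  show "max_sep_num n planar_convex_sets \<le> enat ((n + 1) div 2)"
    unfolding max_sep_num_def by (rule SUP_least) (use sep_num_le_half in auto)
  obtain X where X: "finite X" "card X = n" "enat ((n + 1) div 2) \<le> sep_num X planar_convex_sets"
    using line_sep_num[OF assms] .
  show "enat ((n + 1) div 2) \<le> max_sep_num n planar_convex_sets"
    unfolding max_sep_num_def using X by (intro SUP_upper2[of X]) auto
qed

lemma nat_ceiling_half: "nat \<lceil>real n / 2\<rceil> = (n + 1) div 2"
  by linarith

section \<open>Cups and caps\<close>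

text \<open>Twice the signed area of the triangle: positive for a left turn, negative for a right
  turn, and zero exactly for collinear points.\<close>

definition ori :: "real ^ 2 \<Rightarrow> real ^ 2 \<Rightarrow> real ^ 2 \<Rightarrow> real" where
  "ori p q r = (q $ 1 - p $ 1) * (r $ 2 - p $ 2) - (q $ 2 - p $ 2) * (r $ 1 - p $ 1)"

text \<open>Replacing the first coordinate by \<open>key t\<close> is a shear of determinant 1,
  which preserves signed areas. So everything about cups and caps can be argued with keys as
  abscissas.\<close>

lemma ori_key: "ori p q r = (key t q - key t p) * (r $ 2 - p $ 2) - (q $ 2 - p $ 2) * (key t r - key t p)"
  by (simp add: ori_def key_def algebra_simps)

lemma ori_rotate: "ori q r p = ori p q r"
  by (simp add: ori_def algebra_simps)

lemma ori_swap: "ori p r q = - ori p q r"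
  by (simp add: ori_def algebra_simps)

lemma ori_lin:
  "ori p q (u *\<^sub>R x + v *\<^sub>R y) = u * ori p q x + v * ori p q y" if "u + v = 1"
proof -
  have u: "u = 1 - v" using that by simp
  show ?thesis unfolding u ori_def by (simp add: algebra_simps)
qed

lemma ori_eq_0_iff_collinear:
  assumes "p \<noteq> q"
  shows "collinear {p, q, r} \<longleftrightarrow> ori p q r = 0"
proof -
  have "collinear {p, q, r} \<longleftrightarrow> collinear {q, r, p}"
    by (simp add: insert_commute)
  also have "\<dots> \<longleftrightarrow> (\<exists>c. r = c *\<^sub>R q + (1 - c) *\<^sub>R p)"
    using assms collinear_3_expand[of q r p] by auto
  also have "\<dots> \<longleftrightarrow> (\<exists>c. r - p = c *\<^sub>R (q - p))"
    by (simp add: algebra_simps)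
  also have "\<dots> \<longleftrightarrow> ori p q r = 0"
  proof
    assume "\<exists>c. r - p = c *\<^sub>R (q - p)"
    then obtain c where "r - p = c *\<^sub>R (q - p)" by blast
    then have "r $ 1 - p $ 1 = c * (q $ 1 - p $ 1)" "r $ 2 - p $ 2 = c * (q $ 2 - p $ 2)"
      by (auto simp: vec_eq_iff forall_2)
    then show "ori p q r = 0" by (simp add: ori_def)
  next
    assume o: "ori p q r = 0"
    show "\<exists>c. r - p = c *\<^sub>R (q - p)"
    proof (cases "q $ 1 = p $ 1")
      case True
      then have "q $ 2 \<noteq> p $ 2" using assms by (auto simp: vec_eq_iff forall_2)
      moreover from this have "r $ 1 = p $ 1" using True o by (simp add: ori_def)
      ultimately show ?thesis using True
        by (intro exI[of _ "(r $ 2 - p $ 2) / (q $ 2 - p $ 2)"]) (simp add: vec_eq_iff forall_2)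
    next
      case False
      moreover from this have "r $ 2 - p $ 2 = (r $ 1 - p $ 1) / (q $ 1 - p $ 1) * (q $ 2 - p $ 2)"
        using o by (simp add: ori_def field_simps)
      ultimately show ?thesis
        by (intro exI[of _ "(r $ 1 - p $ 1) / (q $ 1 - p $ 1)"]) (simp add: vec_eq_iff forall_2)
    qed
  qed
  finally show ?thesis .
qed

lemma general_position_ori:
  "general_position X \<longleftrightarrow>
     (\<forall>p\<in>X. \<forall>q\<in>X. \<forall>r\<in>X. p \<noteq> q \<and> q \<noteq> r \<and> p \<noteq> r \<longrightarrow> ori p q r \<noteq> 0)"
  unfolding general_position_def using ori_eq_0_iff_collinear by blast

text \<open>The slopes of \<open>a b\<close>, \<open>b c\<close>, \<open>c d\<close> increase.
  Algebraically, both conclusions, multiplied by the key difference of \<open>b\<close> and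
  \<open>c\<close>, are positive combinations of the two given turns.\<close>

lemma ori_trans:
  assumes "key t a < key t b" "key t b < key t c" "key t c < key t d"
    and "ori a b c > 0" "ori b c d > 0"
  shows "ori a b d > 0" "ori a c d > 0"
proof -
  have "(key t c - key t b) * ori a b d = (key t d - key t b) * ori a b c + (key t b - key t a) * ori b c d"
    by (simp add: ori_key[of _ _ _ t] algebra_simps)
  also have "\<dots> > 0" using assms by (intro add_pos_pos mult_pos_pos) auto
  finally show "ori a b d > 0" using assms by (simp add: zero_less_mult_iff)
  have "(key t c - key t b) * ori a c d = (key t d - key t c) * ori a b c + (key t c - key t a) * ori b c d"
    by (simp add: ori_key[of _ _ _ t] algebra_simps)
  also have "\<dots> > 0" using assms by (intro add_pos_pos mult_pos_pos) auto
  finally show "ori a c d > 0" using assms by (simp add: zero_less_mult_iff)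
qed

lemma ori_trans_neg:
  assumes "key t a < key t b" "key t b < key t c" "key t c < key t d"
    and "ori a b c < 0" "ori b c d < 0"
  shows "ori a b d < 0" "ori a c d < 0"
proof -
  have "(key t c - key t b) * ori a b d = (key t d - key t b) * ori a b c + (key t b - key t a) * ori b c d"
    by (simp add: ori_key[of _ _ _ t] algebra_simps)
  also have "\<dots> < 0" using assms by (intro add_neg_neg mult_pos_neg) auto
  finally show "ori a b d < 0" using assms by (simp add: mult_less_0_iff)
  have "(key t c - key t b) * ori a c d = (key t d - key t c) * ori a b c + (key t c - key t a) * ori b c d"
    by (simp add: ori_key[of _ _ _ t] algebra_simps)
  also have "\<dots> < 0" using assms by (intro add_neg_neg mult_pos_neg) auto
  finally show "ori a c d < 0" using assms by (simp add: mult_less_0_iff)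
qed

text \<open>\<open>chain 1 t\<close> describes cups and \<open>chain (-1) t\<close> caps, where \<open>key t\<close> plays the role of
  the abscissa.\<close>

definition chain :: "real \<Rightarrow> real \<Rightarrow> (real ^ 2) set \<Rightarrow> bool" where
  "chain s t S \<longleftrightarrow> (\<forall>p\<in>S. \<forall>q\<in>S. \<forall>r\<in>S. key t p < key t q \<and> key t q < key t r \<longrightarrow> s * ori p q r > 0)"

lemma chain_subset: "chain s t S \<Longrightarrow> T \<subseteq> S \<Longrightarrow> chain s t T"
  unfolding chain_def by blast

lemma ori_trans_sgn:
  assumes "key t a < key t b" "key t b < key t c" "key t c < key t d"
    and "s * ori a b c > 0" "s * ori b c d > 0"
  shows "s * ori a b d > 0" "s * ori a c d > 0"
  using assms ori_trans[OF assms(1-3)] ori_trans_neg[OF assms(1-3)]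
  by (auto simp: zero_less_mult_iff)

text \<open>Only the last turn, at the old endpoint \<open>y\<close> with its neighbour
  \<open>p\<close>, has to be tested. Transitivity of turns first replaces \<open>p\<close> by any
  earlier point and then \<open>y\<close> by any other middle point.\<close>

lemma chain_insert_right:
  assumes ch: "chain s t S" and inj: "inj_on (key t) S" and y: "y \<in> S" and p: "p \<in> S"
    and max: "\<And>z. z \<in> S \<Longrightarrow> key t z \<le> key t y"
    and py: "key t p < key t y" and pmax: "\<And>z. z \<in> S \<Longrightarrow> z \<noteq> y \<Longrightarrow> key t z \<le> key t p"
    and r: "key t y < key t r" and o: "s * ori p y r > 0"
  shows "chain s t (insert r S)"
proof -
  have 1: "s * ori a y r > 0" if "a \<in> S" "key t a < key t y" for a
  proof (cases "a = p")
    case False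
    then have "key t a < key t p"
      using pmax[of a] that inj p by (metis inj_onD less_irrefl order_le_imp_less_or_eq)
    with that show ?thesis
      using ori_trans_sgn(2)[OF _ py r, of a s] ch p y py o unfolding chain_def by blast
  qed (use o in simp)
  have 2: "s * ori a b r > 0" if "a \<in> S" "b \<in> S" "key t a < key t b" for a b
  proof (cases "b = y")
    case False
    then have "key t b < key t y"
      using max[of b] that inj y by (metis inj_onD order_le_imp_less_or_eq)
    with that show ?thesis
      using ori_trans_sgn(1)[OF that(3) _ r, of s] 1[of b] ch y unfolding chain_def by blast
  qed (use that 1 in auto)
  have 3: "key t z < key t r" if "z \<in> S" for z using max[OF that] r by simp
  show ?thesis
    unfolding chain_def
    using 2 3 ch by (auto simp: chain_def dest: order.asym)
qed

text \<open>The point reflection in the origin reverses the order and the sign of a chain.\<close>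

lemma chain_insert_left:
  assumes ch: "chain s t S" and inj: "inj_on (key t) S" and y: "y \<in> S" and p: "p \<in> S"
    and min: "\<And>z. z \<in> S \<Longrightarrow> key t y \<le> key t z"
    and py: "key t y < key t p" and pmin: "\<And>z. z \<in> S \<Longrightarrow> z \<noteq> y \<Longrightarrow> key t p \<le> key t z"
    and r: "key t r < key t y" and o: "s * ori r y p > 0"
  shows "chain s t (insert r S)"
proof -
  have ori: "ori (- a) (- b) (- c) = - ori c b a" for a b c
    by (simp add: ori_def algebra_simps)
  have key: "key t (- a) = - key t a" for a
    by (simp add: key_def)
  have chm: "chain (- s) t (uminus ` T) \<longleftrightarrow> chain s t T" for T
    unfolding chain_def by (auto simp: ori key)
  have "chain (- s) t (insert (- r) (uminus ` S))"
  proof (rule chain_insert_right[where y = "- y" and p = "- p"])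
    show "inj_on (key t) (uminus ` S)"
      using inj by (auto simp: inj_on_def key)
  qed (use assms in \<open>auto simp: chm key ori\<close>)
  then show ?thesis using chm[of "insert r S"] by simp
qed

lemma ex_max_image:
  fixes f :: "'a \<Rightarrow> real"
  assumes "finite S" "S \<noteq> {}"
  shows "\<exists>y\<in>S. \<forall>z\<in>S. f z \<le> f y"
proof -
  have "Max (f ` S) \<in> f ` S" using assms by (intro Max_in) auto
  then obtain y where "y \<in> S" "f y = Max (f ` S)" by auto
  then show ?thesis using assms by (intro bexI[of _ y]) auto
qed

lemma ex_min_image:
  fixes f :: "'a \<Rightarrow> real"
  assumes "finite S" "S \<noteq> {}"
  shows "\<exists>y\<in>S. \<forall>z\<in>S. f y \<le> f z"
  using ex_max_image[OF assms, of "\<lambda>z. - f z"] by auto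

lemma chain_card_2:
  assumes "card S = 2"
  shows "chain s t S"
  unfolding chain_def
proof (intro ballI impI)
  fix p q r assume *: "p \<in> S" "q \<in> S" "r \<in> S" "key t p < key t q \<and> key t q < key t r"
  obtain x y where "S = {x, y}" using assms by (meson card_2_iff)
  then have "p = q \<or> q = r \<or> p = r" using *(1-3) by (metis insertE singletonD)
  then show "s * ori p q r > 0" using *(4) by (elim disjE) simp_all
qed

text \<open>Let \<open>Y\<close> be the set of right endpoints of cups with \<open>i + 1\<close> points; there is no such cup outside
  \<open>Y\<close>. The left endpoint of a cap in \<open>Y\<close> is the right endpoint of a cup, and one of the two can
  be extended by the neighbour of this endpoint in the other one.\<close>

lemma erdos_szekeres:
  assumes "finite X" "inj_on (key t) X" "general_position X" "card X \<ge> 2 ^ (i + j + 1)"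
  shows "(\<exists>S\<subseteq>X. chain 1 t S \<and> card S = i + 2) \<or> (\<exists>S\<subseteq>X. chain (- 1) t S \<and> card S = j + 2)"
  using assms
proof (induction "i + j" arbitrary: i j X)
  case (0 i j X)
  then have "2 \<le> card X" by simp
  then obtain S where "S \<subseteq> X" "card S = 2"
    by (rule obtain_subset_with_card_n)
  moreover from this have "chain 1 t S" by (intro chain_card_2)
  ultimately show ?case using 0 by auto
next
  case (Suc m i j X)
  have two: "\<exists>S\<subseteq>X. chain s t S \<and> card S = 2" for s
  proof -
    have "(2::nat) ^ 1 \<le> 2 ^ (i + j + 1)" by (rule power_increasing) auto
    then have "2 \<le> card X" using Suc.prems(4) by (metis order_trans power_one_right)
    then obtain S where "S \<subseteq> X" "card S = 2"
      by (rule obtain_subset_with_card_n)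
    then show ?thesis using chain_card_2 by blast
  qed
  show ?case
  proof (cases "i = 0 \<or> j = 0")
    case True
    then show ?thesis using two[of 1] two[of "- 1"] by (elim disjE) (simp_all add: numeral_2_eq_2)
  next
    case False
    then obtain i' j' where ij: "i = Suc i'" "j = Suc j'" by (meson not0_implies_Suc)
    define Y where "Y = {y \<in> X. \<exists>S\<subseteq>X. chain 1 t S \<and> card S = i' + 2 \<and> y \<in> S \<and> (\<forall>z\<in>S. key t z \<le> key t y)}"
    have Y: "Y \<subseteq> X" by (auto simp: Y_def)
    have fY: "finite Y" using Y Suc finite_subset by blast
    have gp: "general_position Z" if "Z \<subseteq> X" for Z
      using Suc.prems(3) that unfolding general_position_def by blast
    \<comment> \<open>The bound \<open>2 ^ (i + j + 1)\<close>, cruder than a binomial coefficient,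
      lets plain halving work: one of the two parts has at least \<open>2 ^ (i + j)\<close>
      points.\<close>
    have "card (X - Y) + card Y = card X"
      using Y fY Suc.prems(1) by (metis card_Diff_subset card_mono le_add_diff_inverse2)
    then consider "card (X - Y) \<ge> 2 ^ (i + j)" | "card Y \<ge> 2 ^ (i + j)"
      using Suc.prems(4) by fastforce
    then show ?thesis
    proof cases
      case 1
      have "(\<exists>S\<subseteq>X-Y. chain 1 t S \<and> card S = i' + 2) \<or> (\<exists>S\<subseteq>X-Y. chain (- 1) t S \<and> card S = j + 2)"
        using Suc 1 ij gp[of "X - Y"] by (intro Suc.hyps(1)) (auto simp: inj_on_diff)
      \<comment> \<open>A cup with \<open>i' + 2 = i + 1\<close> points outside \<open>Y\<close>
        would have its right endpoint in \<open>Y\<close>, so only the cap remains.\<close>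
      moreover have False if S: "S \<subseteq> X - Y" "chain 1 t S" "card S = i' + 2" for S
      proof -
        have "finite S" "S \<noteq> {}" using S by (auto intro: card_ge_0_finite)
        then obtain y where "y \<in> S" "\<forall>z\<in>S. key t z \<le> key t y"
          using ex_max_image by metis
        then have "y \<in> Y" using S by (auto simp: Y_def)
        then show False using S \<open>y \<in> S\<close> by auto
      qed
      ultimately show ?thesis by auto
    next
      case 2
      have "(\<exists>S\<subseteq>Y. chain 1 t S \<and> card S = i + 2) \<or> (\<exists>S\<subseteq>Y. chain (- 1) t S \<and> card S = j' + 2)"
        using Suc 2 ij gp[OF Y] fY inj_on_subset[OF Suc.prems(2) Y]
        by (intro Suc.hyps(1)) auto
      then show ?thesis
      proof
        assume "\<exists>S\<subseteq>Y. chain (- 1) t S \<and> card S = j' + 2"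
        then obtain T where T: "T \<subseteq> Y" "chain (- 1) t T" "card T = j' + 2" by auto
        have fT: "finite T" using T by (auto intro: card_ge_0_finite)
        have "T \<noteq> {}" using T by auto
        obtain y where y: "y \<in> T" "\<forall>z\<in>T. key t y \<le> key t z"
          using ex_min_image fT \<open>T \<noteq> {}\<close> by metis
        have "T - {y} \<noteq> {}" using T(3) y fT card_Diff_singleton[of y T] by force
        obtain r where r: "r \<in> T - {y}" "\<forall>z\<in>T-{y}. key t r \<le> key t z"
          using ex_min_image fT \<open>T - {y} \<noteq> {}\<close> finite_Diff by metis
        obtain S where S: "S \<subseteq> X" "chain 1 t S" "card S = i' + 2" "y \<in> S" "\<forall>z\<in>S. key t z \<le> key t y"
          using y T by (auto simp: Y_def)
        have fS: "finite S" using S by (auto intro: card_ge_0_finite)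
        have "S - {y} \<noteq> {}" using S(3,4) fS card_Diff_singleton[of y S] by force
        obtain p where p: "p \<in> S - {y}" "\<forall>z\<in>S-{y}. key t z \<le> key t p"
          using ex_max_image fS \<open>S - {y} \<noteq> {}\<close> finite_Diff by metis
        have inX: "p \<in> X" "y \<in> X" "r \<in> X" "T \<subseteq> X" using p r S T Y by auto
        have yr: "key t y < key t r"
          using y r inX Suc.prems(2) by (metis DiffE inj_onD order_le_imp_less_or_eq singletonI)
        have py: "key t p < key t y"
          using p S(5) inX Suc.prems(2) by (metis DiffE inj_onD order_le_imp_less_or_eq singletonI)
        have "ori p y r \<noteq> 0"
          using Suc.prems(3) inX yr py unfolding general_position_ori by force
        \<comment> \<open>A left turn at \<open>y\<close> prolongs the cup ending in
          \<open>y\<close> by \<open>r\<close>; a right turn prolongs the cap starting in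
          \<open>y\<close> by \<open>p\<close>.\<close>
        then consider "ori p y r > 0" | "ori p y r < 0" by linarith
        then show ?thesis
        proof cases
          case 1
          have "chain 1 t (insert r S)"
            using S p yr py 1 inj_on_subset[OF Suc.prems(2) S(1)]
            by (intro chain_insert_right[where y = y and p = p]) auto
          moreover have "r \<notin> S" using S(5) yr by force
          ultimately show ?thesis using S fS inX ij by (intro disjI1 exI[of _ "insert r S"]) auto
        next
          case 2
          have "chain (- 1) t (insert p T)"
            using T y r yr py 2 inj_on_subset[OF Suc.prems(2) inX(4)]
            by (intro chain_insert_left[where y = y and p = r]) auto
          moreover have "p \<notin> T" using y py by force
          ultimately show ?thesis using T fT inX ij by (intro disjI2 exI[of _ "insert p T"]) auto
        qed
      qed (use Y in blast)
    qed
  qed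
qed

text \<open>A half-plane contains the other points but not \<open>q\<close>. It is bounded by a
  level line of the key if \<open>q\<close> is an end of the chain, and by the line through the two
  neighbours of \<open>q\<close> otherwise.\<close>

lemma chain_not_in_convex_hull:
  assumes "finite S" "inj_on (key t) S" "chain s t S" "q \<in> S"
  shows "q \<notin> convex hull (S - {q})"
proof -
  have nk: "key t z \<noteq> key t q" if "z \<in> S - {q}" for z
    using assms(2,4) that by (auto dest: inj_onD)
  define L where "L = {z \<in> S. key t z < key t q}"
  define R where "R = {z \<in> S. key t q < key t z}"
  have LR: "S - {q} \<subseteq> L \<union> R" using nk by (force simp: L_def R_def)
  have fin: "finite L" "finite R" using assms(1) by (auto simp: L_def R_def)
  have key_convex: "convex {z. c * key t z < d}" "convex {z. c * ori p r z \<le> 0}" for c d p r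
  proof -
    show "convex {z. c * key t z < d}"
    proof (rule convexI)
      fix x y :: "real ^ 2" and u v :: real
      assume *: "x \<in> {z. c * key t z < d}" "y \<in> {z. c * key t z < d}" "0 \<le> u" "0 \<le> v" "u + v = 1"
      have "u * (c * key t x) + v * (c * key t y) < d"
        using * convex_bound_lt[of "c * key t x" d "c * key t y" u v] by simp
      then show "u *\<^sub>R x + v *\<^sub>R y \<in> {z. c * key t z < d}"
        by (simp add: key_lin algebra_simps)
    qed
    show "convex {z. c * ori p r z \<le> 0}"
    proof (rule convexI)
      fix x y :: "real ^ 2" and u v :: real
      assume *: "x \<in> {z. c * ori p r z \<le> 0}" "y \<in> {z. c * ori p r z \<le> 0}" "0 \<le> u" "0 \<le> v" "u + v = 1"
      have "u * (c * ori p r x) + v * (c * ori p r y) \<le> 0"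
        using * by (intro add_nonpos_nonpos mult_nonneg_nonpos[of _ "c * _"]) auto
      then show "u *\<^sub>R x + v *\<^sub>R y \<in> {z. c * ori p r z \<le> 0}"
        using * by (simp add: ori_lin algebra_simps)
    qed
  qed
  have ex: ?thesis if "convex C" "S - {q} \<subseteq> C" "q \<notin> C" for C
    using that by (meson hull_minimal subsetD)
  consider "L = {}" | "R = {}" | "L \<noteq> {}" "R \<noteq> {}" by blast
  then show ?thesis
  proof cases
    case 1
    show ?thesis
      by (rule ex[OF key_convex(1)[of "-1" "- key t q"]]) (use LR 1 in \<open>auto simp: R_def\<close>)
  next
    case 2
    show ?thesis
      by (rule ex[OF key_convex(1)[of 1 "key t q"]]) (use LR 2 in \<open>auto simp: L_def\<close>)
  next
    case 3
    obtain p where p: "p \<in> L" "\<And>z. z \<in> L \<Longrightarrow> key t z \<le> key t p"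
      using ex_max_image fin(1) 3(1) by metis
    obtain r where r: "r \<in> R" "\<And>z. z \<in> R \<Longrightarrow> key t r \<le> key t z"
      using ex_min_image fin(2) 3(2) by metis
    have S: "p \<in> S" "r \<in> S" "key t p < key t q" "key t q < key t r"
      using p(1) r(1) by (auto simp: L_def R_def)
    have ch: "s * ori a b c > 0" if "a \<in> S" "b \<in> S" "c \<in> S" "key t a < key t b" "key t b < key t c" for a b c
      using assms(3) that unfolding chain_def by blast
    \<comment> \<open>The neighbours lie on the line; every point further out forms a turn of sign
      \<open>s\<close> with \<open>p\<close> and \<open>r\<close>, whereas \<open>q\<close> lies
      strictly on the other side.\<close>
    have "- s * ori p r z \<le> 0" if z: "z \<in> S - {q}" for z
    proof -
      have sp: "ori z p r = ori p r z" by (simp add: ori_rotate)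
      have "z \<in> L \<or> z \<in> R" using z LR by auto
      then consider "z = p" | "z = r" | "key t z < key t p" | "key t r < key t z"
        using p r z S assms(2) by (metis DiffD1 inj_onD order_le_imp_less_or_eq)
      then show ?thesis
      proof cases
        case 3
        then show ?thesis using ch[of z p r] z S by (simp add: sp)
      next
        case 4
        then show ?thesis using ch[of p r z] z S by simp
      qed (auto simp: ori_def)
    qed
    moreover have "s * ori p r q < 0"
      using ch[of p q r] S assms(4) by (simp add: ori_swap[of p r q])
    ultimately show ?thesis
      by (intro ex[OF key_convex(2)[of "- s" p r]]) auto
  qed
qed

text \<open>The points of \<open>T\<close> are extreme points of the hull. An extreme point is never
  interior to a segment in the hull, so no segment between remaining points passes through
  \<open>T\<close>.\<close>

lemma convex_hull_minus_vertices:
  assumes "finite Q" "T \<subseteq> Q" "\<And>q. q \<in> Q \<Longrightarrow> q \<notin> convex hull (Q - {q})"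
  shows "convex (convex hull Q - T)"
proof -
  have "q extreme_point_of (convex hull Q)" if "q \<in> T" for q
  proof -
    have "q \<in> Q" using that assms by auto
    then have "q extreme_point_of (convex hull (insert q (Q - {q})))"
      using assms by (intro extreme_point_of_convex_hull_insert) auto
    then show ?thesis using \<open>q \<in> Q\<close> by (simp add: insert_absorb)
  qed
  then show ?thesis
    unfolding convex_contains_segment
    using convex_convex_hull[of Q, unfolded convex_contains_segment]
    by (auto simp: extreme_point_of_def closed_segment_eq_open)
qed

section \<open>The upper bound for points in general position\<close>

text \<open>The hull minus all its vertices, together with the hull itself, separates \<open>Q\<close> from the rest
  of the plane; removing sets of vertices chosen by binary codes separates the points of \<open>Q\<close>.\<close>

lemma vertices_separated:
  assumes Q: "finite Q" "card Q \<le> 2 ^ c" "\<And>q. q \<in> Q \<Longrightarrow> q \<notin> convex hull (Q - {q})"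
  shows "\<exists>F. finite F \<and> card F \<le> c + 2 \<and> (\<forall>A\<in>F. convex A) \<and>
    (\<forall>x\<in>Q. \<forall>y. x \<noteq> y \<longrightarrow> (\<exists>A\<in>F. separates A x y))"
proof -
  \<comment> \<open>The values of \<open>f\<close> are distinct binary codes of length
    \<open>c\<close>, encoded as sets of positions.\<close>
  have "\<exists>f. f ` Q \<subseteq> Pow {..<c} \<and> inj_on f Q"
    using Q by (intro card_le_inj) (auto simp: card_Pow)
  then obtain f where f: "inj_on f Q" "f ` Q \<subseteq> Pow {..<c}" by blast
  let ?H = "convex hull Q"
  define T where "T b = {x \<in> Q. b \<in> f x}" for b
  define F where "F = insert ?H (insert (?H - Q) ((\<lambda>b. ?H - T b) ` {..<c}))"
  have fin: "finite F" by (simp add: F_def)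
  have "card F \<le> card ((\<lambda>b. ?H - T b) ` {..<c}) + 2"
    unfolding F_def by (simp add: card_insert_if)
  moreover have "card ((\<lambda>b. ?H - T b) ` {..<c}) \<le> c"
    using card_image_le[of "{..<c}" "\<lambda>b. ?H - T b"] by simp
  ultimately have card: "card F \<le> c + 2" by simp
  have conv: "convex A" if "A \<in> F" for A
    using that convex_hull_minus_vertices[OF Q(1) _ Q(3)]
    by (auto simp: F_def T_def convex_convex_hull)
  have sep: "\<exists>A\<in>F. separates A x y" if x: "x \<in> Q" and xy: "x \<noteq> y" for x y
  proof -
    have xH: "x \<in> ?H" using x by (simp add: hull_inc)
    consider "y \<notin> ?H" | "y \<in> ?H - Q" | "y \<in> Q" by blast
    then show ?thesis
    proof cases
      case 1
      then show ?thesis using xH by (intro bexI[of _ ?H]) (auto simp: separates_def F_def)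
    next
      case 2
      then show ?thesis using x by (intro bexI[of _ "?H - Q"]) (auto simp: separates_def F_def)
    next
      case 3
      then have "f x \<noteq> f y" using f(1) x xy by (auto dest: inj_onD)
      then obtain b where b: "(b \<in> f x) \<noteq> (b \<in> f y)" by auto
      then have "b < c" using f(2) x 3 by auto
      moreover have "y \<in> ?H" using 3 by (simp add: hull_inc)
      ultimately show ?thesis using x xH 3 b
        by (intro bexI[of _ "?H - T b"]) (auto simp: separates_def F_def T_def)
    qed
  qed
  show ?thesis using fin card conv sep by blast
qed

text \<open>Chains of \<open>k\<close> points are peeled off at a cost of \<open>c + 2\<close> sets
  each while Erdos-Szekeres provides them; fewer than \<open>4 ^ k\<close> leftover points get
  singletons. Points of \<open>X\<close> are separated from all points of the plane, so that the
  families for \<open>Q\<close> and for \<open>X - Q\<close> can simply be united.\<close>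

lemma greedy_separation:
  assumes "finite X" "inj_on (key t) X" "general_position X" "k \<ge> 2" "k \<le> 2 ^ c"
  shows "\<exists>F. finite F \<and> card F \<le> (card X div k) * (c + 2) + 4 ^ k \<and> (\<forall>A\<in>F. convex A) \<and>
    (\<forall>x\<in>X. \<forall>y. x \<noteq> y \<longrightarrow> (\<exists>A\<in>F. separates A x y))"
  using assms
proof (induction "card X" arbitrary: X rule: less_induct)
  case (less X)
  show ?case
  proof (cases "card X < 4 ^ k")
    case True
    have "card ((\<lambda>x. {x}) ` X) \<le> 4 ^ k"
      using True card_image_le[OF less.prems(1), of "\<lambda>x. {x}"] by simp
    then show ?thesis using less.prems(1)
      by (intro exI[of _ "(\<lambda>x. {x}) ` X"]) (auto simp: separates_def)
  next
    case False
    obtain i where k: "k = i + 2" using \<open>k \<ge> 2\<close> by (metis le_add_diff_inverse2)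
    have "(2::nat) ^ (i + i + 1) \<le> 2 ^ (2 * k)" by (rule power_increasing) (auto simp: k)
    also have "\<dots> = 4 ^ k" by (simp add: power_mult)
    finally have "2 ^ (i + i + 1) \<le> card X" using False by simp
    from erdos_szekeres[OF less.prems(1-3) this]
    obtain s Q where Q: "Q \<subseteq> X" "chain s t Q" "card Q = k" unfolding k by blast
    have fQ: "finite Q" using Q less.prems(1) finite_subset by blast
    have "q \<notin> convex hull (Q - {q})" if "q \<in> Q" for q
      using chain_not_in_convex_hull[OF fQ inj_on_subset[OF less.prems(2) Q(1)] Q(2) that] .
    with vertices_separated[OF fQ] obtain G where G: "finite G" "card G \<le> c + 2"
        "\<forall>A\<in>G. convex A" "\<forall>x\<in>Q. \<forall>y. x \<noteq> y \<longrightarrow> (\<exists>A\<in>G. separates A x y)"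
      using Q(3) \<open>k \<le> 2 ^ c\<close> by metis
    have kX: "k \<le> card X" using card_mono[OF less.prems(1) Q(1)] Q(3) by simp
    have cXQ: "card (X - Q) = card X - k"
      using Q fQ by (simp add: card_Diff_subset)
    have gp: "general_position (X - Q)"
      using less.prems(3) unfolding general_position_def by blast
    have "card (X - Q) < card X" using cXQ kX \<open>k \<ge> 2\<close> by simp
    from less.hyps[OF this _ _ gp \<open>k \<ge> 2\<close> \<open>k \<le> 2 ^ c\<close>]
    obtain F where F: "finite F" "card F \<le> (card (X - Q) div k) * (c + 2) + 4 ^ k" "\<forall>A\<in>F. convex A"
      "\<forall>x\<in>X-Q. \<forall>y. x \<noteq> y \<longrightarrow> (\<exists>A\<in>F. separates A x y)"
      using less.prems(1,2) by (metis finite_Diff inj_on_diff)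
    have "card X div k = card (X - Q) div k + 1"
      using kX \<open>k \<ge> 2\<close> cXQ by (simp add: le_div_geq)
    then have "card (F \<union> G) \<le> (card X div k) * (c + 2) + 4 ^ k"
      using F(2) G(2) card_Un_le[of F G] by simp
    moreover have "\<forall>x\<in>X. \<forall>y. x \<noteq> y \<longrightarrow> (\<exists>A\<in>F \<union> G. separates A x y)"
      using F(4) G(4) by (metis Diff_iff UnCI)
    ultimately show ?thesis using F(1,3) G(1,3) by (intro exI[of _ "F \<union> G"]) auto
  qed
qed

lemma sep_num_general_position_le:
  assumes "finite X" "general_position X" "k \<ge> 2" "k \<le> 2 ^ c"
  shows "sep_num X planar_convex_sets \<le> enat ((card X div k) * (c + 2) + 4 ^ k)"
proof -
  obtain t where t: "inj_on (key t) X" using ex_inj_key[OF assms(1)] .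
  from greedy_separation[OF assms(1) t assms(2-4)]
  obtain F where F: "finite F" "card F \<le> (card X div k) * (c + 2) + 4 ^ k" "\<forall>A\<in>F. convex A"
    "\<forall>x\<in>X. \<forall>y. x \<noteq> y \<longrightarrow> (\<exists>A\<in>F. separates A x y)" by blast
  have "sep_num X planar_convex_sets \<le> enat (card F)"
    using F by (intro sep_num_le) auto
  also have "\<dots> \<le> enat ((card X div k) * (c + 2) + 4 ^ k)" using F by simp
  finally show ?thesis .
qed

section \<open>Numerical estimates for the upper bound\<close>

lemma power_real_le_powr:
  assumes "b > 1" "real k \<le> x"
  shows "b ^ k \<le> b powr x"
  using assms by (simp flip: powr_realpow)

text \<open>With \<open>k\<close> about \<open>L / 4\<close>, the leftover \<open>4 ^ k\<close> is
  at most the square root of \<open>n\<close>, hence at most \<open>n / L\<close>. There are at most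
  \<open>5 * n / L\<close> polygons, each costing \<open>c + 2 \<le> l + 1 \<le> 2 * l\<close>
  sets.\<close>

lemma upper_bound_large:
  fixes n :: nat
  assumes "n \<ge> 2" and L: "log 2 (real n) \<ge> 64"
  shows "\<exists>k c. k \<ge> 2 \<and> k \<le> 2 ^ c \<and>
    real ((n div k) * (c + 2) + 4 ^ k) \<le> 20 * real n * log 2 (log 2 (real n)) / log 2 (real n)"
proof -
  define L where "L = log 2 (real n)"
  define l where "l = log 2 L"
  have L64: "L \<ge> 64" using L by (simp add: L_def)
  define k where "k = nat \<lfloor>L / 4\<rfloor>"
  \<comment> \<open>Here \<open>l - 2\<close> is the logarithm of \<open>L / 4\<close>, so codes of
    length \<open>c\<close> suffice for \<open>k\<close> vertices.\<close>
  define c where "c = nat \<lceil>l - 2\<rceil>"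
  have kL: "real k \<le> L / 4" "L / 4 - 1 < real k" using L64 unfolding k_def by linarith+
  have "log 2 64 \<le> l" unfolding l_def using L64 by (subst log_le_cancel_iff) auto
  moreover have "log 2 64 = (6::real)" using log_pow_cancel[of 2 6] by simp
  ultimately have l6: "l \<ge> 6" by simp
  have cl: "l - 2 \<le> real c" "real c \<le> l - 1" using l6 unfolding c_def by linarith+
  have k15: "real k \<ge> 2" using kL L64 by linarith
  have "real k \<le> L / 4" by (rule kL)
  also have "\<dots> = 2 powr (l - 2)" using L64 by (simp add: powr_diff l_def)
  also have "\<dots> \<le> 2 powr real c" using cl by simp
  also have "\<dots> = real (2 ^ c)" by (simp add: powr_realpow)
  finally have k2c: "k \<le> 2 ^ c" by (simp only: of_nat_le_iff)
  have n: "real n = 2 powr L" using assms by (simp add: L_def)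
  have "real (4 ^ k) = 2 ^ (2 * k)" by (simp add: power_mult)
  also have "\<dots> \<le> 2 powr (L / 2)" using kL by (intro power_real_le_powr) auto
  finally have 1: "real (4 ^ k) \<le> 2 powr (L / 2)" .
  \<comment> \<open>Squaring \<open>1 + L / 8 \<le> 2 powr (L / 4)\<close> gives a quadratic lower
    bound, which exceeds \<open>L\<close> once \<open>L\<close> is at least 56.\<close>
  have "L \<le> 2 powr (L / 2)"
  proof -
    have "ln 2 \<ge> (1/2::real)" using ln2_ge_two_thirds by linarith
    then have "1 + (L / 4) * (1 / 2) \<le> 1 + (L / 4) * ln 2"
      using L64 by (intro add_left_mono mult_left_mono) auto
    also have "\<dots> \<le> exp ((L / 4) * ln 2)" by (rule exp_ge_add_one_self)
    also have "\<dots> = 2 powr (L / 4)" by (simp add: powr_def)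
    finally have a: "1 + L / 8 \<le> 2 powr (L / 4)" by simp
    have "L \<le> (L / 8) * (1 + L / 8)" using L64 by (simp add: field_simps)
    also have "\<dots> \<le> (1 + L / 8) * (1 + L / 8)" using L64 by (intro mult_right_mono) auto
    also have "\<dots> \<le> 2 powr (L / 4) * 2 powr (L / 4)" using a L64 by (intro mult_mono) auto
    also have "\<dots> = 2 powr (L / 2)" by (simp flip: powr_add)
    finally show ?thesis .
  qed
  then have "L * 2 powr (L / 2) \<le> 2 powr (L / 2) * 2 powr (L / 2)" by (intro mult_right_mono) auto
  also have "\<dots> = real n" by (simp add: n flip: powr_add)
  finally have 2: "2 powr (L / 2) \<le> real n / L" using L64 by (simp add: field_simps)
  have "real ((n div k) * (c + 2)) \<le> (real n / real k) * (l + 1)"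
    unfolding of_nat_mult using cl by (intro mult_mono of_nat_div_le_of_nat) auto
  also have "\<dots> \<le> (real n * (5 / L)) * (2 * l)"
  proof (rule mult_mono)
    have "L \<le> 5 * real k" using kL L64 by linarith
    then have "1 / real k \<le> 5 / L" using k15 L64 by (simp add: field_simps)
    then have "real n * (1 / real k) \<le> real n * (5 / L)" by (intro mult_left_mono) auto
    then show "real n / real k \<le> real n * (5 / L)" by simp
  qed (use l6 L64 in auto)
  also have "\<dots> = 10 * (real n / L) * l" by simp
  finally have 3: "real ((n div k) * (c + 2)) \<le> 10 * (real n / L) * l" .
  have "real ((n div k) * (c + 2) + 4 ^ k) \<le> 10 * (real n / L) * l + (real n / L) * 1"
    using 1 2 3 by simp
  also have "\<dots> \<le> 10 * (real n / L) * l + (real n / L) * (10 * l)"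
    using l6 L64 by (intro add_left_mono mult_left_mono) auto
  also have "\<dots> = 20 * real n * l / L" by simp
  finally show ?thesis using k15 k2c unfolding l_def L_def
    by (intro exI[of _ k] exI[of _ c]) auto
qed

text \<open>In this range even \<open>n\<close> sets are allowed, because
  \<open>L \<le> 20 * log 2 L\<close>. For \<open>n = 2\<close> the right-hand side would be 0; from
  \<open>n = 3\<close> on, \<open>L\<close> is at least \<open>3 / 2\<close> and its logarithm at
  least \<open>1 / 2\<close>.\<close>

lemma upper_bound_small:
  assumes "n \<ge> 3" and "log 2 (real n) < 64"
  shows "real n \<le> 20 * real n * log 2 (log 2 (real n)) / log 2 (real n)"
proof -
  define L where "L = log 2 (real n)"
  have "log 2 (2 powr (3 / 2)) \<le> L"
    unfolding L_def
  proof (subst log_le_cancel_iff)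
    have "(2 powr (3 / 2)) ^ 2 = (2::real) powr 3"
      by (simp add: power2_eq_square flip: powr_add)
    also have "\<dots> = 2 ^ 3" by (subst powr_realpow[symmetric]) auto
    also have "\<dots> \<le> (real n) ^ 2" using power_mono[of 3 "real n" 2] assms by simp
    finally show "2 powr (3 / 2) \<le> real n" by (rule power2_le_imp_le) simp
  qed (use assms in auto)
  then have L1: "3 / 2 \<le> L" by simp
  have "log 2 (2 powr (1 / 2)) \<le> log 2 L"
  proof (subst log_le_cancel_iff)
    have "(2 powr (1 / 2)) ^ 2 = (2::real)"
      by (simp add: power2_eq_square flip: powr_add)
    moreover have "(3 / 2) ^ 2 \<le> L ^ 2" by (rule power_mono[OF L1]) simp
    moreover have "(3 / 2 :: real) ^ 2 = 9 / 4" by (simp add: power2_eq_square)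
    ultimately have "(2 powr (1 / 2)) ^ 2 \<le> L ^ 2" by linarith
    then show "2 powr (1 / 2) \<le> L" by (rule power2_le_imp_le) (use L1 in linarith)
  qed (use L1 in auto)
  then have half: "1 / 2 \<le> log 2 L" by simp
  have pow: "real j \<le> log 2 L" if "2 ^ j \<le> L" for j
    using that le_log_of_power[of 2 j L] by simp
  have "L < 64" using assms by (simp add: L_def)
  have "L \<le> 20 * log 2 L"
  proof -
    \<comment> \<open>On the three ranges \<open>log 2 L\<close> is at least \<open>1 / 2\<close>, 2
      and 4, which makes the right-hand side at least 10, 40 and 80.\<close>
    consider "L \<le> 10" | "10 < L" "L \<le> 16" | "16 < L" by linarith
    then show ?thesis
    proof cases
      case 1
      then show ?thesis using half by linarith
    next
      case 2
      then show ?thesis using pow[of 2] by simp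
    next
      case 3
      then show ?thesis using pow[of 4] \<open>L < 64\<close> by simp
    qed
  qed
  then have "real n * 1 \<le> real n * (20 * log 2 L / L)"
    using L1 by (intro mult_left_mono) (auto simp: field_simps)
  then show ?thesis by (simp add: L_def mult_ac)
qed

lemma max_sep_num_gp_upper:
  assumes n: "n \<ge> 3"
  shows "ereal_of_enat (max_sep_num_gp n planar_convex_sets)
    \<le> ereal (20 * real n * log 2 (log 2 (real n)) / log 2 (real n))" (is "_ \<le> ereal ?v")
proof -
  have *: "max_sep_num_gp n planar_convex_sets \<le> enat m"
    if "\<And>X. finite X \<Longrightarrow> card X = n \<Longrightarrow> general_position X \<Longrightarrow> sep_num X planar_convex_sets \<le> enat m" for m
    unfolding max_sep_num_gp_def by (rule SUP_least) (use that in auto)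
  have **: ?thesis if "max_sep_num_gp n planar_convex_sets \<le> enat m" "real m \<le> ?v" for m
  proof -
    have "ereal_of_enat (max_sep_num_gp n planar_convex_sets) \<le> ereal_of_enat (enat m)"
      using that(1) by (simp only: ereal_of_enat_le_iff)
    also have "\<dots> \<le> ereal ?v" using that(2) by simp
    finally show ?thesis .
  qed
  show ?thesis
  proof (cases "log 2 (real n) < 64")
    case True
    have "max_sep_num_gp n planar_convex_sets \<le> enat n"
    proof (rule *)
      fix X :: "(real ^ 2) set" assume "finite X" "card X = n"
      then have "sep_num X planar_convex_sets \<le> enat ((n + 1) div 2)" by (rule sep_num_le_half)
      also have "\<dots> \<le> enat n" using n by simp
      finally show "sep_num X planar_convex_sets \<le> enat n" .
    qed
    then show ?thesis using upper_bound_small[OF n True] by (rule **)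
  next
    case False
    then obtain k c where "k \<ge> 2" "k \<le> 2 ^ c" and v: "real ((n div k) * (c + 2) + 4 ^ k) \<le> ?v"
      using upper_bound_large[of n] n by auto
    then have "max_sep_num_gp n planar_convex_sets \<le> enat ((n div k) * (c + 2) + 4 ^ k)"
      using sep_num_general_position_le[of _ k c] by (intro *) auto
    then show ?thesis using v by (rule **)
  qed
qed

section \<open>The lower bound for points in general position\<close>

lemma key_0 [simp]: "key 0 p = p $ 1"
  by (simp add: key_def)

definition generic :: "(real ^ 2) set \<Rightarrow> bool" where
  "generic P \<longleftrightarrow> finite P \<and> inj_on (\<lambda>p. p $ 1) P \<and>
    (\<forall>p\<in>P. \<forall>q\<in>P. \<forall>r\<in>P. p $ 1 < q $ 1 \<and> q $ 1 < r $ 1 \<longrightarrow> ori p q r \<noteq> 0)"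

definition chains_le :: "real \<Rightarrow> nat \<Rightarrow> (real ^ 2) set \<Rightarrow> bool" where
  "chains_le s m P \<longleftrightarrow> (\<forall>S\<subseteq>P. chain s 0 S \<longrightarrow> card S \<le> m)"

text \<open>\<open>Q\<close> lies to the right of \<open>P\<close> and so far up (\<open>s = 1\<close>) or down (\<open>s = -1\<close>) that every line
  through two points of one set has the whole other set on one side.\<close>

definition far :: "real \<Rightarrow> (real ^ 2) set \<Rightarrow> (real ^ 2) set \<Rightarrow> bool" where
  "far s P Q \<longleftrightarrow> (\<forall>p\<in>P. \<forall>q\<in>Q. p $ 1 < q $ 1) \<and>
    (\<forall>p\<in>P. \<forall>p'\<in>P. \<forall>q\<in>Q. p $ 1 < p' $ 1 \<longrightarrow> s * ori p p' q > 0) \<and>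
    (\<forall>p\<in>P. \<forall>q\<in>Q. \<forall>q'\<in>Q. q $ 1 < q' $ 1 \<longrightarrow> s * ori p q q' < 0)"

lemma eventually_affine_pos:
  fixes a b :: real
  assumes "a > 0"
  shows "\<forall>\<^sub>F h in at_top. a * h + b > 0"
  using eventually_gt_at_top[of "- b / a"]
proof eventually_elim
  case (elim h)
  then show ?case using assms by (simp add: field_simps)
qed

text \<open>The horizontal shift \<open>M\<close> puts \<open>Q\<close> to the right of
  \<open>P\<close>. Each orientation condition is then affine in the height \<open>h\<close> with a
  leading coefficient of the right sign, and finitely many such conditions hold together for large
  \<open>h\<close>.\<close>

lemma ex_far_translate:
  assumes fin: "finite P" "finite Q" and s: "s * s = 1"
  shows "\<exists>v. far s P ((+) v ` Q)"
proof -
  define M where "M = Max ((\<lambda>(p, q). p $ 1 - q $ 1) ` (P \<times> Q)) + 1"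
  have M: "p $ 1 - q $ 1 < M" if "p \<in> P" "q \<in> Q" for p q
  proof -
    have "p $ 1 - q $ 1 \<le> Max ((\<lambda>(p, q). p $ 1 - q $ 1) ` (P \<times> Q))"
      using that fin by (intro Max_ge) force+
    then show ?thesis by (simp add: M_def)
  qed
  define v :: "real \<Rightarrow> real ^ 2" where "v h = vector [M, s * h]" for h
  have "\<forall>\<^sub>F h in at_top. \<forall>p\<in>P. \<forall>p'\<in>P. \<forall>q\<in>Q. p $ 1 < p' $ 1 \<longrightarrow> s * ori p p' (v h + q) > 0"
  proof (intro eventually_ball_finite fin ballI)
    fix p p' q assume "p \<in> P" "p' \<in> P" "q \<in> Q"
    show "\<forall>\<^sub>F h in at_top. p $ 1 < p' $ 1 \<longrightarrow> s * ori p p' (v h + q) > 0"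
    proof (cases "p $ 1 < p' $ 1")
      case True
      have "s * ori p p' (v h + q) = (p' $ 1 - p $ 1) * h +
          s * ((p' $ 1 - p $ 1) * (q $ 2 - p $ 2) - (p' $ 2 - p $ 2) * (M + q $ 1 - p $ 1))" for h
      proof -
        have "s * ori p p' (v h + q) = (s * s) * ((p' $ 1 - p $ 1) * h) +
          s * ((p' $ 1 - p $ 1) * (q $ 2 - p $ 2) - (p' $ 2 - p $ 2) * (M + q $ 1 - p $ 1))"
          by (simp add: ori_def v_def algebra_simps)
        then show ?thesis by (simp add: s)
      qed
      then show ?thesis using True eventually_affine_pos by simp
    qed simp
  qed
  moreover have "\<forall>\<^sub>F h in at_top. \<forall>p\<in>P. \<forall>q\<in>Q. \<forall>q'\<in>Q. q $ 1 < q' $ 1 \<longrightarrow> s * ori p (v h + q) (v h + q') < 0"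
  proof (intro eventually_ball_finite fin ballI)
    fix p q q' assume "p \<in> P" "q \<in> Q" "q' \<in> Q"
    show "\<forall>\<^sub>F h in at_top. q $ 1 < q' $ 1 \<longrightarrow> s * ori p (v h + q) (v h + q') < 0"
    proof (cases "q $ 1 < q' $ 1")
      case True
      have "s * ori p (v h + q) (v h + q') = - ((q' $ 1 - q $ 1) * h +
          s * ((q $ 2 - p $ 2) * (M + q' $ 1 - p $ 1) - (M + q $ 1 - p $ 1) * (q' $ 2 - p $ 2)))" for h
      proof -
        have "s * ori p (v h + q) (v h + q') = - ((s * s) * ((q' $ 1 - q $ 1) * h) +
          s * ((q $ 2 - p $ 2) * (M + q' $ 1 - p $ 1) - (M + q $ 1 - p $ 1) * (q' $ 2 - p $ 2)))"
          by (simp add: ori_def v_def algebra_simps)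
        then show ?thesis by (simp add: s)
      qed
      then show ?thesis using True
        by (simp only: simp_thms neg_less_0_iff_less) (rule eventually_affine_pos, simp)
    qed simp
  qed
  ultimately have "\<forall>\<^sub>F h in at_top. far s P ((+) (v h) ` Q)"
  proof eventually_elim
    case (elim h)
    have "\<forall>p\<in>P. \<forall>q\<in>Q. p $ 1 < v h $ 1 + q $ 1" using M by (force simp: v_def)
    with elim show ?case unfolding far_def by simp
  qed
  then show ?thesis using eventually_happens trivial_limit_at_top_linorder by blast
qed

lemma ori_translate: "ori (v + p) (v + q) (v + r) = ori p q r"
  by (simp add: ori_def)

lemma generic_translate: "generic P \<Longrightarrow> generic ((+) v ` P)"
  by (auto simp: generic_def inj_on_def ori_translate)

lemma chain_translate: "chain s 0 ((+) v ` S) \<longleftrightarrow> chain s 0 S"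
  by (simp add: chain_def ori_translate)

lemma chains_le_translate: "chains_le s m P \<Longrightarrow> chains_le s m ((+) v ` P)"
  unfolding chains_le_def
  by (metis card_image chain_translate inj_on_add subset_imageE)

lemma far_disjoint: "far s P Q \<Longrightarrow> P \<inter> Q = {}"
  unfolding far_def by force

lemma generic_subset: "generic P \<Longrightarrow> S \<subseteq> P \<Longrightarrow> generic S"
  unfolding generic_def by (meson finite_subset inj_on_subset subsetD)

lemma far_generic:
  assumes "far s P Q" "generic P" "generic Q"
  shows "generic (P \<union> Q)"
proof -
  have PQ: "p $ 1 < q $ 1" if "p \<in> P" "q \<in> Q" for p q
    using assms(1) that by (auto simp: far_def)
  have a: "ori p p' q \<noteq> 0" if "p \<in> P" "p' \<in> P" "q \<in> Q" "p $ 1 < p' $ 1" for p p' q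
    using assms(1) that unfolding far_def by force
  have b: "ori p q q' \<noteq> 0" if "p \<in> P" "q \<in> Q" "q' \<in> Q" "q $ 1 < q' $ 1" for p q q'
    using assms(1) that unfolding far_def by force
  have inj: "inj_on (\<lambda>p. p $ 1) (P \<union> Q)"
    using assms(2,3) PQ unfolding generic_def inj_on_Un by force
  have "ori p q r \<noteq> 0"
    if pqr: "p \<in> P \<union> Q" "q \<in> P \<union> Q" "r \<in> P \<union> Q" and lt: "p $ 1 < q $ 1" "q $ 1 < r $ 1" for p q r
  proof -
    have "q \<in> P \<Longrightarrow> p \<in> P" "r \<in> P \<Longrightarrow> q \<in> P"
      using pqr lt PQ[of q p] PQ[of r q] by auto
    then consider "p \<in> P" "q \<in> P" "r \<in> P" | "p \<in> P" "q \<in> P" "r \<in> Q"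
      | "p \<in> P" "q \<in> Q" "r \<in> Q" | "p \<in> Q" "q \<in> Q" "r \<in> Q"
      using pqr by blast
    then show ?thesis
      by cases (use lt a b assms(2,3) in \<open>auto simp: generic_def\<close>)
  qed
  then show ?thesis using inj assms(2,3) unfolding generic_def by blast
qed

lemma generic_card_le_1:
  assumes "generic P" "\<And>x y. x \<in> P \<Longrightarrow> y \<in> P \<Longrightarrow> x $ 1 < y $ 1 \<Longrightarrow> False"
  shows "card P \<le> 1"
proof (rule ccontr)
  assume "\<not> card P \<le> 1"
  then obtain x y where "x \<in> P" "y \<in> P" "x \<noteq> y"
    by (metis One_nat_def card.empty card_1_singleton_iff card_le_Suc0_iff_eq generic_def assms(1))
  then show False
    using assms unfolding generic_def by (metis inj_onD linorder_neqE_linordered_idom)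
qed

text \<open>A point of \<open>P\<close> and two points of \<open>Q\<close> turn with sign
  \<open>- s\<close>. So a chain of sign \<open>s\<close> that meets \<open>P\<close> has at most
  one point in \<open>Q\<close>.\<close>

lemma far_chains_le:
  assumes far: "far s P Q" and gen: "generic P" "generic Q" and le: "chains_le s m P" "chains_le s m' Q"
  shows "chains_le s (max (m + 1) m') (P \<union> Q)"
  unfolding chains_le_def
proof (intro allI impI)
  fix S assume S: "S \<subseteq> P \<union> Q" "chain s 0 S"
  have *: "card (S \<inter> P) \<le> m" "card (S \<inter> Q) \<le> m'"
    using le S(2) chain_subset unfolding chains_le_def by (metis Int_lower1 Int_lower2)+
  have "S = (S \<inter> P) \<union> (S \<inter> Q)" using S by auto
  then have c: "card S \<le> card (S \<inter> P) + card (S \<inter> Q)" by (metis card_Un_le)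
  show "card S \<le> max (m + 1) m'"
  proof (cases "S \<inter> P = {}")
    case True
    then show ?thesis using c * by simp
  next
    case False
    then obtain p where p: "p \<in> S" "p \<in> P" by auto
    have "card (S \<inter> Q) \<le> 1"
    proof (rule generic_card_le_1[OF generic_subset[OF gen(2)]])
      fix x y assume xy: "x \<in> S \<inter> Q" "y \<in> S \<inter> Q" "x $ 1 < y $ 1"
      then have "s * ori p x y < 0" "p $ 1 < x $ 1" using far p unfolding far_def by auto
      then show False using S(2) p xy unfolding chain_def by force
    qed auto
    then show ?thesis using c * by simp
  qed
qed

text \<open>Two points of \<open>P\<close> and a point of \<open>Q\<close> turn with sign
  \<open>s\<close>. So a chain of sign \<open>- s\<close> that meets \<open>Q\<close> has at most
  one point in \<open>P\<close>.\<close>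

lemma far_chains_le_neg:
  assumes far: "far s P Q" and gen: "generic P" "generic Q"
    and le: "chains_le (- s) m P" "chains_le (- s) m' Q"
  shows "chains_le (- s) (max m (m' + 1)) (P \<union> Q)"
  unfolding chains_le_def
proof (intro allI impI)
  fix S assume S: "S \<subseteq> P \<union> Q" "chain (- s) 0 S"
  have *: "card (S \<inter> P) \<le> m" "card (S \<inter> Q) \<le> m'"
    using le S(2) chain_subset unfolding chains_le_def by (metis Int_lower1 Int_lower2)+
  have "S = (S \<inter> P) \<union> (S \<inter> Q)" using S by auto
  then have c: "card S \<le> card (S \<inter> P) + card (S \<inter> Q)" by (metis card_Un_le)
  show "card S \<le> max m (m' + 1)"
  proof (cases "S \<inter> Q = {}")
    case True
    then show ?thesis using c * by simp
  next
    case False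
    then obtain q where q: "q \<in> S" "q \<in> Q" by auto
    have "card (S \<inter> P) \<le> 1"
    proof (rule generic_card_le_1[OF generic_subset[OF gen(1)]])
      fix x y assume xy: "x \<in> S \<inter> P" "y \<in> S \<inter> P" "x $ 1 < y $ 1"
      then have "s * ori x y q > 0" "y $ 1 < q $ 1" using far q unfolding far_def by auto
      then show False using S(2) q xy unfolding chain_def by force
    qed auto
    then show ?thesis using c * by simp
  qed
qed

text \<open>Induction along Pascal's rule: the block for \<open>i, j - 1\<close> is joined with a
  copy of the block for \<open>i - 1, j\<close> far up to its right. Caps grow by one only through
  the second block and cups only through the first.\<close>

lemma erdos_szekeres_block:
  "\<exists>P. generic P \<and> card P = (i + j) choose i \<and> chains_le (- 1) (i + 1) P \<and> chains_le 1 (j + 1) P"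
proof (induction "i + j" arbitrary: i j rule: less_induct)
  case less
  show ?case
  proof (cases "i = 0 \<or> j = 0")
    case True
    have "card S \<le> k + 1" if "S \<subseteq> {0 :: real ^ 2}" for S k
      using card_mono[OF _ that] by simp
    then show ?thesis using True
      by (intro exI[of _ "{0}"]) (auto simp: generic_def chains_le_def)
  next
    case False
    then obtain a b where ab: "i = Suc a" "j = Suc b" by (meson not0_implies_Suc)
    have "i + b < i + j" "a + j < i + j" by (simp_all add: ab)
    from less.hyps[OF this(1)] less.hyps[OF this(2)] obtain P Q where
      P: "generic P" "card P = (i + b) choose i" "chains_le (- 1) (i + 1) P" "chains_le 1 (b + 1) P" and
      Q: "generic Q" "card Q = (a + j) choose a" "chains_le (- 1) (a + 1) Q" "chains_le 1 (j + 1) Q"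
      by blast
    obtain v where v: "far 1 P ((+) v ` Q)"
      using ex_far_translate[of P Q 1] P(1) Q(1) by (auto simp: generic_def)
    let ?Q = "(+) v ` Q"
    have Q': "generic ?Q" "card ?Q = (a + j) choose a" "chains_le (- 1) (a + 1) ?Q" "chains_le 1 (j + 1) ?Q"
      using Q by (auto simp: generic_translate chains_le_translate card_image)
    have "card (P \<union> ?Q) = (i + b choose i) + (a + j choose a)"
      using P Q' far_disjoint[OF v] by (subst card_Un_disjoint) (auto simp: generic_def)
    also have "\<dots> = (i + j) choose i" by (simp add: ab)
    finally have "card (P \<union> ?Q) = (i + j) choose i" .
    moreover have "chains_le (- 1) (i + 1) (P \<union> ?Q)"
      using far_chains_le_neg[OF v P(1) Q'(1) P(3) Q'(3)] by (simp add: ab)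
    moreover have "chains_le 1 (j + 1) (P \<union> ?Q)"
      using far_chains_le[OF v P(1) Q'(1) P(4) Q'(4)] by (simp add: ab)
    ultimately show ?thesis using far_generic[OF v P(1) Q'(1)] by blast
  qed
qed

section \<open>Convex position and the Erdos-Szekeres set\<close>

definition inside :: "real ^ 2 \<Rightarrow> real ^ 2 \<Rightarrow> real ^ 2 \<Rightarrow> real ^ 2 \<Rightarrow> bool" where
  "inside a b c x \<longleftrightarrow> (ori a b x > 0 \<and> ori b c x > 0 \<and> ori c a x > 0) \<or>
    (ori a b x < 0 \<and> ori b c x < 0 \<and> ori c a x < 0)"

text \<open>Expressed by orientations of triples, which perturbation arguments can handle. The four
  points may be chosen with repetitions: an orientation then vanishes and \<open>inside\<close>
  fails.\<close>

definition convex_position :: "(real ^ 2) set \<Rightarrow> bool" where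
  "convex_position S \<longleftrightarrow> (\<forall>a\<in>S. \<forall>b\<in>S. \<forall>c\<in>S. \<forall>x\<in>S. \<not> inside a b c x)"

text \<open>The three signed areas divided by their sum are the barycentric coordinates of
  \<open>x\<close>.\<close>

lemma inside_imp_mem_convex:
  assumes "inside a b c x" "convex C" "a \<in> C" "b \<in> C" "c \<in> C"
  shows "x \<in> C"
proof -
  let ?u = "ori b c x" and ?v = "ori c a x" and ?w = "ori a b x"
  define D where "D = ?u + ?v + ?w"
  have D: "D > 0 \<and> ?u > 0 \<and> ?v > 0 \<and> ?w > 0 \<or> D < 0 \<and> ?u < 0 \<and> ?v < 0 \<and> ?w < 0"
    using assms(1) by (auto simp: inside_def D_def)
  then have nn: "D \<noteq> 0" "0 \<le> ?u / D" "0 \<le> ?v / D" "0 \<le> ?w / D"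
    by (auto simp: zero_le_divide_iff)
  have sum: "?u / D + ?v / D + ?w / D = 1"
    using nn(1) by (simp add: D_def flip: add_divide_distrib)
  have "D *\<^sub>R x = ?u *\<^sub>R a + ?v *\<^sub>R b + ?w *\<^sub>R c"
    by (simp add: vec_eq_iff forall_2 D_def ori_def algebra_simps)
  then have "(1 / D) *\<^sub>R D *\<^sub>R x = (1 / D) *\<^sub>R (?u *\<^sub>R a + ?v *\<^sub>R b + ?w *\<^sub>R c)" by simp
  then have x: "x = (?u / D) *\<^sub>R a + (?v / D) *\<^sub>R b + (?w / D) *\<^sub>R c"
    using nn(1) by (simp add: scaleR_add_right)
  have "x \<in> convex hull {a, b, c}"
    unfolding convex_hull_3 using nn sum x by blast
  then show ?thesis using hull_minimal[of "{a, b, c}" C convex] assms by auto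
qed

text \<open>The Pluecker relation between the three vectors starting at \<open>x\<close> and the
  vertical direction.\<close>

lemma ori_vertical: "(p $ 1 - x $ 1) * ori x q r + (r $ 1 - x $ 1) * ori x p q = (q $ 1 - x $ 1) * ori x p r"
  by (simp add: ori_def algebra_simps)

text \<open>The point \<open>x\<close> lies below the segment \<open>a b\<close> and above
  \<open>a' b'\<close>. If it lies above \<open>a b'\<close>, it is caught between the segments
  \<open>a b\<close> and \<open>a b'\<close>; otherwise it is caught between \<open>a b'\<close> and
  \<open>a' b'\<close>.\<close>

lemma between_inside:
  assumes lt: "a $ 1 < x $ 1" "x $ 1 < b $ 1" "a' $ 1 < x $ 1" "x $ 1 < b' $ 1"
    and o: "ori a x b > 0" "ori a' x b' < 0" "ori a x b' \<noteq> 0"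
  shows "inside a b b' x \<or> inside a a' b' x"
proof (cases "ori a x b' < 0")
  case True
  have o': "ori x b a > 0" "ori x b' a < 0"
    using o True by (simp_all add: ori_rotate)
  have "(b' $ 1 - x $ 1) * ori x b a > 0" "(b $ 1 - x $ 1) * ori x b' a < 0"
    using o' lt by (auto intro: mult_pos_neg)
  moreover have "(a $ 1 - x $ 1) * ori x b b' + (b' $ 1 - x $ 1) * ori x a b = (b $ 1 - x $ 1) * ori x a b'"
    by (rule ori_vertical)
  moreover have "ori x a b = - ori x b a" "ori x a b' = - ori x b' a"
    by (simp_all add: ori_swap[of x a])
  ultimately have "(a $ 1 - x $ 1) * ori x b b' > 0" by simp
  then have "ori x b b' < 0" using lt by (simp add: zero_less_mult_iff)
  then have "inside a b b' x"
    using o True unfolding inside_def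
    by (metis (no_types, opaque_lifting) neg_less_0_iff_less ori_rotate ori_swap)
  then show ?thesis ..
next
  case False
  then have F: "ori a x b' > 0" using o by simp
  have o': "ori x b' a > 0" "ori x b' a' < 0"
    using o F by (simp_all add: ori_rotate)
  have "(b' $ 1 - x $ 1) * ori x a a' + (a' $ 1 - x $ 1) * ori x b' a = (a $ 1 - x $ 1) * ori x b' a'"
    by (rule ori_vertical)
  moreover have "(a' $ 1 - x $ 1) * ori x b' a < 0" "(a $ 1 - x $ 1) * ori x b' a' > 0"
    using o' lt by (auto intro: mult_neg_pos mult_neg_neg)
  ultimately have "(b' $ 1 - x $ 1) * ori x a a' > 0" by simp
  then have "ori x a a' > 0" using lt by (simp add: zero_less_mult_iff)
  then have "inside a a' b' x"
    using o F unfolding inside_def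
    by (metis (no_types, opaque_lifting) neg_less_0_iff_less neg_0_less_iff_less ori_rotate ori_swap)
  then show ?thesis ..
qed

text \<open>A point of \<open>S\<close> that is above one segment and below another one spanned by \<open>S\<close> is inside a
  triangle; hence in convex position \<open>S\<close> is the union of its upper and its lower hull.\<close>

lemma convex_position_card_le:
  assumes "generic P" "S \<subseteq> P" "convex_position S" "chains_le (- 1) u P" "chains_le 1 l P"
  shows "card S \<le> u + l"
proof -
  have gen: "generic S" using assms generic_subset by blast
  define U where "U = {x \<in> S. \<not> (\<exists>a\<in>S. \<exists>b\<in>S. a $ 1 < x $ 1 \<and> x $ 1 < b $ 1 \<and> ori a x b > 0)}"
  define D where "D = {x \<in> S. \<not> (\<exists>a\<in>S. \<exists>b\<in>S. a $ 1 < x $ 1 \<and> x $ 1 < b $ 1 \<and> ori a x b < 0)}"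
  have no: "ori p q r \<noteq> 0" if "p \<in> S" "q \<in> S" "r \<in> S" "p $ 1 < q $ 1" "q $ 1 < r $ 1" for p q r
    using gen that unfolding generic_def by blast
  have "chain (- 1) 0 U"
    unfolding chain_def key_0
  proof (intro ballI impI)
    fix p q r assume "p \<in> U" "q \<in> U" "r \<in> U" "p $ 1 < q $ 1 \<and> q $ 1 < r $ 1"
    then have "ori p q r \<noteq> 0" "\<not> ori p q r > 0"
      using no[of p q r] unfolding U_def by blast+
    then show "- 1 * ori p q r > 0" by simp
  qed
  moreover have "chain 1 0 D"
    unfolding chain_def key_0
  proof (intro ballI impI)
    fix p q r assume "p \<in> D" "q \<in> D" "r \<in> D" "p $ 1 < q $ 1 \<and> q $ 1 < r $ 1"
    then have "ori p q r \<noteq> 0" "\<not> ori p q r < 0"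
      using no[of p q r] unfolding D_def by blast+
    then show "1 * ori p q r > 0" by simp
  qed
  moreover have "U \<subseteq> P" "D \<subseteq> P" using assms(2) by (auto simp: U_def D_def)
  ultimately have "card U \<le> u" "card D \<le> l"
    using assms(4,5) unfolding chains_le_def by blast+
  moreover have "S \<subseteq> U \<union> D"
  proof
    fix x assume x: "x \<in> S"
    show "x \<in> U \<union> D"
    proof (rule ccontr)
      assume "x \<notin> U \<union> D"
      then obtain a b a' b' where ab: "a \<in> S" "b \<in> S" "a' \<in> S" "b' \<in> S"
        "a $ 1 < x $ 1" "x $ 1 < b $ 1" "a' $ 1 < x $ 1" "x $ 1 < b' $ 1"
        "ori a x b > 0" "ori a' x b' < 0"
        using x by (auto simp: U_def D_def)
      then have "inside a b b' x \<or> inside a a' b' x"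
        using x no by (intro between_inside) auto
      then show False using assms(3) ab x unfolding convex_position_def by blast
    qed
  qed
  then have "card S \<le> card (U \<union> D)"
    using gen by (intro card_mono) (auto simp: generic_def U_def D_def)
  ultimately show ?thesis using card_Un_le[of U D] by linarith
qed

text \<open>Seen from \<open>P\<close>, the set \<open>Q\<close> is far below: if three points of
  \<open>S\<close> in \<open>P\<close> formed a cup, the middle one would be inside the triangle of
  the outer two and \<open>b\<close>. Dually, the middle point of a cap in \<open>Q\<close> would be
  inside a triangle with \<open>a\<close>.\<close>

lemma far_convex_position:
  assumes far: "far (- 1) P Q" and gen: "generic P" "generic Q"
    and S: "convex_position S" "S \<inter> P \<noteq> {}" "S \<inter> Q \<noteq> {}"
  shows "chain (- 1) 0 (S \<inter> P)" "chain 1 0 (S \<inter> Q)"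
proof -
  obtain a b where a: "a \<in> S" "a \<in> P" and b: "b \<in> S" "b \<in> Q" using S by blast
  show "chain (- 1) 0 (S \<inter> P)"
    unfolding chain_def
  proof (intro ballI impI)
    fix p q r assume pqr: "p \<in> S \<inter> P" "q \<in> S \<inter> P" "r \<in> S \<inter> P" "key 0 p < key 0 q \<and> key 0 q < key 0 r"
    then have "ori p q b < 0" "ori q r b < 0"
      using far b unfolding far_def by force+
    moreover have "\<not> inside p r b q" using S(1) pqr a b unfolding convex_position_def by blast
    moreover have "ori r b q = ori q r b" "ori b p q = ori p q b" by (metis ori_rotate)+
    ultimately have "\<not> ori p r q < 0" by (auto simp: inside_def)
    moreover have "ori p q r \<noteq> 0" using gen pqr unfolding generic_def by auto
    ultimately show "- 1 * ori p q r > 0" using ori_swap[of p r q] by simp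
  qed
  show "chain 1 0 (S \<inter> Q)"
    unfolding chain_def
  proof (intro ballI impI)
    fix x y z assume xyz: "x \<in> S \<inter> Q" "y \<in> S \<inter> Q" "z \<in> S \<inter> Q" "key 0 x < key 0 y \<and> key 0 y < key 0 z"
    then have "ori a x y > 0" "ori a y z > 0"
      using far a unfolding far_def by force+
    moreover have "\<not> inside a x z y" using S(1) xyz a b unfolding convex_position_def by blast
    moreover have "ori z a y = ori a y z" by (metis ori_rotate)
    ultimately have "\<not> ori x z y > 0" by (auto simp: inside_def)
    moreover have "ori x y z \<noteq> 0" using gen xyz unfolding generic_def by auto
    ultimately show "1 * ori x y z > 0" using ori_swap[of x z y] by simp
  qed
qed

text \<open>Blocks of \<open>K choose t\<close> points are placed one after the other, each far down
  to the right of its predecessors. The bound on caps is carried along because a set in convex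
  position that meets both the old part and the new block consists of a cap in the former and a cup
  in the latter.\<close>

lemma erdos_szekeres_partial_set:
  "i \<le> K \<Longrightarrow> \<exists>P. generic P \<and> card P = (\<Sum>t\<le>i. K choose t) \<and> chains_le (- 1) (i + 1) P \<and>
    (\<forall>S\<subseteq>P. convex_position S \<longrightarrow> card S \<le> K + 2)"
proof (induction i)
  case 0
  have "card S \<le> k + 1" if "S \<subseteq> {0 :: real ^ 2}" for S k
    using card_mono[OF _ that] by simp
  then show ?case
    by (intro exI[of _ "{0}"]) (fastforce simp: generic_def chains_le_def)
next
  case (Suc i)
  then obtain P where P: "generic P" "card P = (\<Sum>t\<le>i. K choose t)" "chains_le (- 1) (i + 1) P"
    "\<And>S. S \<subseteq> P \<Longrightarrow> convex_position S \<Longrightarrow> card S \<le> K + 2" by auto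
  define j where "j = K - Suc i"
  have K: "Suc i + j = K" using Suc.prems by (simp add: j_def)
  obtain Q where Q: "generic Q" "card Q = K choose Suc i" "chains_le (- 1) (i + 2) Q" "chains_le 1 (j + 1) Q"
    using erdos_szekeres_block[of "Suc i" j] unfolding K by auto
  obtain v where v: "far (- 1) P ((+) v ` Q)"
    using ex_far_translate[of P Q "- 1"] P(1) Q(1) by (auto simp: generic_def)
  let ?Q = "(+) v ` Q"
  have Q': "generic ?Q" "card ?Q = K choose Suc i" "chains_le (- 1) (i + 2) ?Q" "chains_le 1 (j + 1) ?Q"
    using Q by (auto simp: generic_translate chains_le_translate card_image)
  have "card (P \<union> ?Q) = (\<Sum>t\<le>Suc i. K choose t)"
    using P Q' far_disjoint[OF v] by (subst card_Un_disjoint) (auto simp: generic_def)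
  moreover have "chains_le (- 1) (Suc i + 1) (P \<union> ?Q)"
    using far_chains_le[OF v P(1) Q'(1) P(3) Q'(3)] by simp
  moreover have "card S \<le> K + 2" if S: "S \<subseteq> P \<union> ?Q" "convex_position S" for S
  proof -
    consider "S \<subseteq> P" | "S \<subseteq> ?Q" | "S \<inter> P \<noteq> {}" "S \<inter> ?Q \<noteq> {}" using S by blast
    then show ?thesis
    proof cases
      case 1
      then show ?thesis using P S by blast
    next
      case 2
      \<comment> \<open>Within one block, the upper hull has at most \<open>i + 2\<close> and the
        lower hull at most \<open>j + 1\<close> points. Their sum is \<open>K + 2\<close>, as
        \<open>Suc i + j = K\<close>.\<close>
      then have "card S \<le> (i + 2) + (j + 1)"
        using convex_position_card_le[OF Q'(1) _ S(2) Q'(3,4)] by blast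
      then show ?thesis using K by simp
    next
      case 3
      have "card (S \<inter> P) \<le> i + 1" "card (S \<inter> ?Q) \<le> j + 1"
        using far_convex_position[OF v P(1) Q'(1) S(2) 3] P(3) Q'(4)
        unfolding chains_le_def by (meson Int_lower2)+
      moreover have "S = (S \<inter> P) \<union> (S \<inter> ?Q)" using S by auto
      then have "card S \<le> card (S \<inter> P) + card (S \<inter> ?Q)" by (metis card_Un_le)
      ultimately show ?thesis using K by simp
    qed
  qed
  ultimately show ?case using far_generic[OF v P(1) Q'(1)] by blast
qed

lemma erdos_szekeres_set:
  obtains P where "finite P" "card P = 2 ^ K" "\<And>S. S \<subseteq> P \<Longrightarrow> convex_position S \<Longrightarrow> card S \<le> K + 2"
proof -
  obtain P where "generic P" "card P = (\<Sum>t\<le>K. K choose t)"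
    "\<forall>S\<subseteq>P. convex_position S \<longrightarrow> card S \<le> K + 2"
    using erdos_szekeres_partial_set[of K K] by auto
  then show ?thesis using that[of P] choose_row_sum[of K] by (auto simp: generic_def)
qed

section \<open>Perturbation into general position, and clusters\<close>

lemma negligible_line:
  assumes "p \<noteq> q"
  shows "negligible {z. ori p q z = 0}"
proof -
  define a :: "real ^ 2" where "a = vector [- (q $ 2 - p $ 2), q $ 1 - p $ 1]"
  have "a \<noteq> 0" using assms by (auto simp: a_def vec_eq_iff forall_2)
  then have "negligible {z. a \<bullet> z = a \<bullet> p}" by (intro negligible_hyperplane) simp
  moreover have "ori p q z = a \<bullet> z - a \<bullet> p" for z
    by (simp add: ori_def a_def inner_vec_def sum_2 algebra_simps)
  ultimately show ?thesis by simp
qed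

lemma general_position_insert:
  assumes "general_position Y" "\<And>p q. p \<in> Y \<Longrightarrow> q \<in> Y \<Longrightarrow> p \<noteq> q \<Longrightarrow> ori p q z \<noteq> 0"
  shows "general_position (insert z Y)"
  unfolding general_position_ori
proof (intro ballI impI)
  fix p q r assume *: "p \<in> insert z Y" "q \<in> insert z Y" "r \<in> insert z Y" "p \<noteq> q \<and> q \<noteq> r \<and> p \<noteq> r"
  then consider "p \<in> Y" "q \<in> Y" "r \<in> Y" | "p = z" "q \<in> Y" "r \<in> Y" | "q = z" "p \<in> Y" "r \<in> Y"
    | "r = z" "p \<in> Y" "q \<in> Y" by blast
  then show "ori p q r \<noteq> 0"
  proof cases
    case 1
    then show ?thesis using assms(1) * unfolding general_position_ori by blast
  next
    case 2
    then show ?thesis using assms(2)[of q r] * by (simp add: ori_rotate)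
  next
    case 3
    then have "ori r p z \<noteq> 0" using assms(2)[of r p] * by blast
    then show ?thesis using 3(1) ori_rotate[of p z r] by simp
  next
    case 4
    then show ?thesis using assms(2)[of p q] * by simp
  qed
qed

text \<open>The points are chosen one by one: earlier points and the lines through two of them form
  a null set, which cannot cover a ball. The centres \<open>c i\<close> may coincide, and this
  produces clusters.\<close>

lemma general_position_approx:
  fixes c :: "nat \<Rightarrow> real ^ 2"
  assumes e: "e > 0"
  shows "\<exists>f. inj_on f {..<n} \<and> general_position (f ` {..<n}) \<and> (\<forall>i<n. dist (c i) (f i) < e)"
proof (induction n)
  case 0
  show ?case by (auto simp: general_position_def)
next
  case (Suc n)
  then obtain f where f: "inj_on f {..<n}" "general_position (f ` {..<n})" "\<forall>i<n. dist (c i) (f i) < e"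
    by blast
  let ?Y = "f ` {..<n}"
  define N where "N = ?Y \<union> (\<Union>(p, q)\<in>{(p, q) \<in> ?Y \<times> ?Y. p \<noteq> q}. {z. ori p q z = 0})"
  have "finite {(p, q) \<in> ?Y \<times> ?Y. p \<noteq> q}"
    by (rule finite_subset[of _ "?Y \<times> ?Y"]) auto
  then have "negligible N"
    unfolding N_def using negligible_line
    by (intro negligible_Un negligible_Union) (auto simp: negligible_finite)
  moreover have "\<not> negligible (ball (c n) e)"
    using e by (intro open_not_negligible) auto
  ultimately obtain z where z: "z \<in> ball (c n) e" "z \<notin> N"
    using negligible_subset by blast
  let ?g = "f(n := z)"
  have img: "?g ` {..<Suc n} = insert z ?Y" by (auto simp: lessThan_Suc)
  have "inj_on ?g {..<Suc n}"
    using f(1) z(2) by (auto simp: inj_on_def N_def less_Suc_eq)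
  moreover have "general_position (?g ` {..<Suc n})"
    unfolding img using z(2) by (intro general_position_insert f(2)) (auto simp: N_def)
  moreover have "\<forall>i<Suc n. dist (c i) (?g i) < e"
    using f(3) z(1) by (auto simp: less_Suc_eq)
  ultimately show ?case by blast
qed

lemma ori_pos_nearby:
  assumes "ori a b c > 0"
  shows "\<exists>e>0. \<forall>a' b' c'. dist a a' < e \<and> dist b b' < e \<and> dist c c' < e \<longrightarrow> ori a' b' c' > 0"
proof -
  let ?S = "{z. ori (fst z) (fst (snd z)) (snd (snd z)) > 0}"
  have "open ?S"
    unfolding ori_def by (intro open_Collect_less continuous_intros)
  moreover have "(a, b, c) \<in> ?S" using assms by simp
  ultimately obtain A T where A: "open A" "open T" "(a, b, c) \<in> A \<times> T" "A \<times> T \<subseteq> ?S"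
    by (rule open_prod_elim)
  then have "(b, c) \<in> T" by auto
  with A(2) obtain B C where B: "open B" "open C" "(b, c) \<in> B \<times> C" "B \<times> C \<subseteq> T"
    by (rule open_prod_elim)
  have "a \<in> A" "b \<in> B" "c \<in> C" using A B by auto
  then obtain ea eb ec where e: "ea > 0" "ball a ea \<subseteq> A" "eb > 0" "ball b eb \<subseteq> B" "ec > 0" "ball c ec \<subseteq> C"
    using A(1) B(1,2) by (meson openE)
  have "ori a' b' c' > 0" if "dist a a' < min ea (min eb ec)" "dist b b' < min ea (min eb ec)"
    "dist c c' < min ea (min eb ec)" for a' b' c'
  proof -
    have "a' \<in> A" "b' \<in> B" "c' \<in> C" using e that by (auto simp: subset_iff)
    then have "(a', b', c') \<in> ?S" using A(4) B(4) by blast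
    then show ?thesis by simp
  qed
  then show ?thesis using e by (intro exI[of _ "min ea (min eb ec)"]) auto
qed

text \<open>All inequalities in \<open>inside\<close> are strict, hence stable, and finitely many
  triples admit a common radius.\<close>

lemma inside_nearby:
  assumes "finite P"
  shows "\<exists>e>0. \<forall>a\<in>P. \<forall>b\<in>P. \<forall>c\<in>P. \<forall>x\<in>P. inside a b c x \<longrightarrow>
    (\<forall>a' b' c' x'. dist a a' < e \<and> dist b b' < e \<and> dist c c' < e \<and> dist x x' < e \<longrightarrow> inside a' b' c' x')"
proof -
  have "\<forall>\<^sub>F e in at_right 0. \<forall>a\<in>P. \<forall>b\<in>P. \<forall>c\<in>P. ori a b c > 0 \<longrightarrow>
    (\<forall>a' b' c'. dist a a' < e \<and> dist b b' < e \<and> dist c c' < e \<longrightarrow> ori a' b' c' > 0)"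
  proof (intro eventually_ball_finite assms ballI)
    fix a b c
    show "\<forall>\<^sub>F e in at_right 0. ori a b c > 0 \<longrightarrow>
      (\<forall>a' b' c'. dist a a' < e \<and> dist b b' < e \<and> dist c c' < e \<longrightarrow> ori a' b' c' > 0)"
    proof (cases "ori a b c > 0")
      case True
      then obtain d where "d > 0" and d: "\<And>a' b' c'. dist a a' < d \<Longrightarrow> dist b b' < d \<Longrightarrow> dist c c' < d \<Longrightarrow> ori a' b' c' > 0"
        using ori_pos_nearby by blast
      then show ?thesis
        unfolding eventually_at_right_field
        by (intro exI[of _ d] conjI allI impI) (auto intro: d)
    qed simp
  qed
  moreover have "\<forall>\<^sub>F e in at_right (0::real). e > 0" by (rule eventually_at_right_less)
  ultimately have "\<forall>\<^sub>F e in at_right 0. e > 0 \<and> (\<forall>a\<in>P. \<forall>b\<in>P. \<forall>c\<in>P. ori a b c > 0 \<longrightarrow>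
    (\<forall>a' b' c'. dist a a' < e \<and> dist b b' < e \<and> dist c c' < e \<longrightarrow> ori a' b' c' > 0))"
    by eventually_elim blast
  then obtain e where e: "e > 0" "\<forall>a\<in>P. \<forall>b\<in>P. \<forall>c\<in>P. ori a b c > 0 \<longrightarrow>
      (\<forall>a' b' c'. dist a a' < e \<and> dist b b' < e \<and> dist c c' < e \<longrightarrow> ori a' b' c' > 0)"
    using eventually_happens'[OF trivial_limit_at_right_real] by blast
  have pos: "ori a' b' c' > 0" if "a \<in> P" "b \<in> P" "c \<in> P" "ori a b c > 0"
      "dist a a' < e" "dist b b' < e" "dist c c' < e" for a b c a' b' c'
    using e(2)[rule_format, OF that(1-4)] that(5-7) by simp
  have neg: "ori a' b' c' < 0" if "a \<in> P" "b \<in> P" "c \<in> P" "ori a b c < 0"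
      "dist a a' < e" "dist b b' < e" "dist c c' < e" for a b c a' b' c'
  proof -
    have "ori a c b > 0" using that(4) ori_swap[of a c b] by linarith
    then have "ori a' c' b' > 0" by (rule pos[OF that(1,3,2) _ that(5,7,6)])
    then show ?thesis using ori_swap[of a' c' b'] by linarith
  qed
  have "inside a' b' c' x'" if *: "a \<in> P" "b \<in> P" "c \<in> P" "x \<in> P" and i: "inside a b c x"
      and d: "dist a a' < e" "dist b b' < e" "dist c c' < e" "dist x x' < e" for a b c x a' b' c' x'
    using i unfolding inside_def
  proof (elim disjE conjE)
    assume "ori a b x > 0" "ori b c x > 0" "ori c a x > 0"
    then show "ori a' b' x' > 0 \<and> ori b' c' x' > 0 \<and> ori c' a' x' > 0 \<or>
        ori a' b' x' < 0 \<and> ori b' c' x' < 0 \<and> ori c' a' x' < 0"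
      using pos[OF *(1,2,4) _ d(1,2,4)] pos[OF *(2,3,4) _ d(2,3,4)] pos[OF *(3,1,4) _ d(3,1,4)]
      by blast
  next
    assume "ori a b x < 0" "ori b c x < 0" "ori c a x < 0"
    then show "ori a' b' x' > 0 \<and> ori b' c' x' > 0 \<and> ori c' a' x' > 0 \<or>
        ori a' b' x' < 0 \<and> ori b' c' x' < 0 \<and> ori c' a' x' < 0"
      using neg[OF *(1,2,4) _ d(1,2,4)] neg[OF *(2,3,4) _ d(2,3,4)] neg[OF *(3,1,4) _ d(3,1,4)]
      by blast
  qed
  then show ?thesis using e(1) by blast
qed

text \<open>Double counting of the pairs of a convex set and a cluster it cuts: each set cuts at
  most \<open>K + 2\<close> clusters, and each of the \<open>m\<close> clusters is cut by at least
  two sets.\<close>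

lemma clustered_set:
  assumes m: "3 * m \<le> n" "m \<le> 2 ^ K"
  obtains X where "finite X" "card X = n" "general_position X"
    "\<And>F. finite F \<Longrightarrow> (\<And>A. A \<in> F \<Longrightarrow> convex A) \<Longrightarrow>
      (\<And>x y. x \<in> X \<Longrightarrow> y \<in> X \<Longrightarrow> x \<noteq> y \<Longrightarrow> \<exists>A\<in>F. separates A x y) \<Longrightarrow> 2 * m \<le> card F * (K + 2)"
proof -
  obtain P where P: "finite P" "card P = 2 ^ K" "\<And>S. S \<subseteq> P \<Longrightarrow> convex_position S \<Longrightarrow> card S \<le> K + 2"
    using erdos_szekeres_set[of K] by blast
  obtain h where "bij_betw h {0..<card P} P" using ex_bij_betw_nat_finite[OF P(1)] by blast
  then have h: "inj_on h {..<m}" "\<And>i. i < m \<Longrightarrow> h i \<in> P"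
    using m(2) P(2) by (auto simp: bij_betw_def inj_on_def)
  obtain e where "e > 0" and e: "\<And>a b c x a' b' c' x'. a \<in> P \<Longrightarrow> b \<in> P \<Longrightarrow> c \<in> P \<Longrightarrow> x \<in> P \<Longrightarrow>
      inside a b c x \<Longrightarrow> dist a a' < e \<Longrightarrow> dist b b' < e \<Longrightarrow> dist c c' < e \<Longrightarrow> dist x x' < e \<Longrightarrow> inside a' b' c' x'"
    using inside_nearby[OF P(1)] by blast
  \<comment> \<open>The indices \<open>3 * t\<close>, \<open>3 * t + 1\<close> and
    \<open>3 * t + 2\<close> share the centre \<open>h t\<close>; those from \<open>3 * m\<close> on
    bring the number of points up to \<open>n\<close>.\<close>
  obtain f where f: "inj_on f {..<n}" "general_position (f ` {..<n})" "\<forall>i<n. dist (h (i div 3)) (f i) < e"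
    using general_position_approx[OF \<open>e > 0\<close>, of n "\<lambda>i. h (i div 3)"] by blast
  define cl where "cl t = {3 * t, 3 * t + 1, 3 * t + 2}" for t :: nat
  have cl: "i < n" "dist (h t) (f i) < e" if "i \<in> cl t" "t < m" for i t
  proof -
    have "i < n" "i div 3 = t" using that m(1) by (auto simp: cl_def)
    then show "i < n" "dist (h t) (f i) < e" using f(3) by auto
  qed
  have "2 * m \<le> card F * (K + 2)" if fin: "finite F" and cv: "\<And>A. A \<in> F \<Longrightarrow> convex A"
    and sep: "\<And>x y. x \<in> f ` {..<n} \<Longrightarrow> y \<in> f ` {..<n} \<Longrightarrow> x \<noteq> y \<Longrightarrow> \<exists>A\<in>F. separates A x y" for F
  proof -
    define cut where "cut A t \<longleftrightarrow> (\<exists>i\<in>cl t. \<exists>j\<in>cl t. f i \<in> A \<and> f j \<notin> A)" for A t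
    have le: "card {t. t < m \<and> cut A t} \<le> K + 2" if A: "A \<in> F" for A
    proof -
      let ?S = "h ` {t. t < m \<and> cut A t}"
      have "convex_position ?S"
        unfolding convex_position_def
      proof (intro ballI notI)
        fix a b c x assume *: "a \<in> ?S" "b \<in> ?S" "c \<in> ?S" "x \<in> ?S" "inside a b c x"
        have near: "\<exists>i j. f i \<in> A \<and> f j \<notin> A \<and> dist y (f i) < e \<and> dist y (f j) < e \<and> y \<in> P"
          if "y \<in> ?S" for y
          using that cl h(2) by (auto simp: cut_def) blast
        obtain ia ib ic jx where "f ia \<in> A" "f ib \<in> A" "f ic \<in> A" "f jx \<notin> A"
          "dist a (f ia) < e" "dist b (f ib) < e" "dist c (f ic) < e" "dist x (f jx) < e"
          "a \<in> P" "b \<in> P" "c \<in> P" "x \<in> P"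
          using near[OF *(1)] near[OF *(2)] near[OF *(3)] near[OF *(4)] by blast
        \<comment> \<open>Near \<open>a\<close>, \<open>b\<close>, \<open>c\<close> there are points
          in \<open>A\<close>, and near \<open>x\<close> there is one outside \<open>A\<close>. The
          latter is still inside the triangle of the former, against the convexity of
          \<open>A\<close>.\<close>
        then show False
          using e[OF _ _ _ _ *(5)] inside_imp_mem_convex cv[OF A] by blast
      qed
      then have "card ?S \<le> K + 2" using h(2) by (intro P(3)) auto
      moreover have "inj_on h {t. t < m \<and> cut A t}" using h(1) by (rule inj_on_subset) auto
      ultimately show ?thesis by (simp add: card_image)
    qed
    have ge: "2 \<le> card {A \<in> F. cut A t}" if t: "t < m" for t
    proof (rule ccontr)
      let ?C = "{A \<in> F. cut A t}"
      assume "\<not> 2 \<le> card ?C"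
      then have 1: "A = B" if "A \<in> ?C" "B \<in> ?C" for A B
        using that fin card_le_Suc0_iff_eq[of ?C] by auto
      have ex: "\<exists>A\<in>?C. separates A (f i) (f j)" if "i \<in> cl t" "j \<in> cl t" "i \<noteq> j" for i j
      proof -
        have ij: "i < n" "j < n" using that cl(1) t by blast+
        then have "f i \<noteq> f j" using that f(1) by (auto dest: inj_onD)
        then obtain A where "A \<in> F" "separates A (f i) (f j)"
          using sep[of "f i" "f j"] ij by blast
        then show ?thesis using that by (auto simp: cut_def separates_def)
      qed
      have in_cl: "3 * t \<in> cl t" "3 * t + 1 \<in> cl t" "3 * t + 2 \<in> cl t" by (auto simp: cl_def)
      obtain A where A: "A \<in> ?C" "separates A (f (3 * t)) (f (3 * t + 1))"
        using ex[OF in_cl(1,2)] by auto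
      obtain B where B: "B \<in> ?C" "separates B (f (3 * t)) (f (3 * t + 2))"
        using ex[OF in_cl(1,3)] by auto
      obtain D where D: "D \<in> ?C" "separates D (f (3 * t + 1)) (f (3 * t + 2))"
        using ex[OF in_cl(2,3)] by auto
      have "B = A" "D = A" using 1 A(1) B(1) D(1) by blast+
      \<comment> \<open>A single set leaves two of the three points of the cluster on the same
        side.\<close>
      then show False using A(2) B(2) D(2) by (simp add: separates_def)
    qed
    have "2 * m = (\<Sum>t<m. 2)" by simp
    also have "\<dots> \<le> (\<Sum>t<m. card {A \<in> F. cut A t})" using ge by (intro sum_mono) auto
    also have "\<dots> = (\<Sum>A\<in>F. card {t. t < m \<and> cut A t})"
      using sum_multicount_gen[of "{..<m}" F "\<lambda>t A. cut A t" "\<lambda>A. card {t. t < m \<and> cut A t}"] fin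
      by simp
    also have "\<dots> \<le> (\<Sum>A\<in>F. K + 2)" using le by (intro sum_mono)
    finally show ?thesis by simp
  qed
  moreover have "card (f ` {..<n}) = n" using f(1) by (simp add: card_image)
  ultimately show ?thesis using that[of "f ` {..<n}"] f(2) by blast
qed

section \<open>Small cases and numerical estimates for the lower bound\<close>

lemma card_le_power_separating:
  assumes "finite F" "\<And>x y. x \<in> X \<Longrightarrow> y \<in> X \<Longrightarrow> x \<noteq> y \<Longrightarrow> \<exists>A\<in>F. separates A x y"
  shows "card X \<le> 2 ^ card F"
proof -
  let ?g = "\<lambda>x. {A \<in> F. x \<in> A}"
  have "inj_on ?g X"
  proof (rule inj_onI)
    fix x y assume xy: "x \<in> X" "y \<in> X" "?g x = ?g y"
    show "x = y"
    proof (rule ccontr)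
      assume "x \<noteq> y"
      then obtain A where "A \<in> F" "separates A x y" using assms(2) xy by blast
      then show False using xy(3) by (auto simp: separates_def)
    qed
  qed
  moreover have "?g ` X \<subseteq> Pow F" by auto
  ultimately have "card X \<le> card (Pow F)" using assms(1) by (intro card_inj_on_le) auto
  then show ?thesis using assms(1) by (simp add: card_Pow)
qed

lemma max_sep_num_gp_ge:
  assumes X: "finite X" "card X = n" "general_position X"
    and F: "\<And>F. finite F \<Longrightarrow> (\<And>A. A \<in> F \<Longrightarrow> convex A) \<Longrightarrow>
      (\<And>x y. x \<in> X \<Longrightarrow> y \<in> X \<Longrightarrow> x \<noteq> y \<Longrightarrow> \<exists>A\<in>F. separates A x y) \<Longrightarrow> v \<le> real (card F)"
  shows "ereal v \<le> ereal_of_enat (max_sep_num_gp n planar_convex_sets)"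
proof -
  have "enat (nat \<lceil>v\<rceil>) \<le> sep_num X planar_convex_sets"
    by (rule le_sep_num) (use F in \<open>simp add: ceiling_le_iff nat_le_iff\<close>)
  also have "\<dots> \<le> max_sep_num_gp n planar_convex_sets"
    unfolding max_sep_num_gp_def using X by (intro SUP_upper) auto
  finally have "ereal_of_enat (enat (nat \<lceil>v\<rceil>)) \<le> ereal_of_enat (max_sep_num_gp n planar_convex_sets)"
    by (simp only: ereal_of_enat_le_iff)
  moreover have "v \<le> real (nat \<lceil>v\<rceil>)" by linarith
  then have "ereal v \<le> ereal_of_enat (enat (nat \<lceil>v\<rceil>))" by simp
  ultimately show ?thesis by (rule order_trans[rotated])
qed

text \<open>For small \<open>n\<close> counting membership patterns suffices. If
  \<open>2 ^ j < n\<close>, then \<open>b\<close> is at least \<open>j + 1\<close> and the logarithm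
  at least \<open>j\<close>, so \<open>n \<le> 2 * (j + 1) * j\<close> is enough. For
  \<open>j = 5\<close> this reads \<open>n \<le> 60\<close>, which fixes the threshold.\<close>

lemma small_log_bound:
  assumes "2 \<le> n" "n \<le> 60" "n \<le> 2 ^ b"
  shows "real n / (2 * log 2 (real n)) \<le> real b"
proof -
  have *: ?thesis if j: "2 ^ j < n" "real n \<le> 2 * real (j + 1) * real j" for j
  proof -
    have "(2::nat) ^ j < 2 ^ b" using j(1) assms(3) by linarith
    then have "j + 1 \<le> b" by (simp add: power_strict_increasing_iff)
    moreover have "real j \<le> log 2 (real n)"
      using j(1) by (intro le_log_of_power) (auto simp: less_imp_le simp flip: of_nat_power of_nat_le_iff)
    ultimately have "real (j + 1) * real j \<le> real b * log 2 (real n)"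
      by (intro mult_mono) auto
    then have "real n \<le> real b * (2 * log 2 (real n))" using j(2) by linarith
    moreover have "log 2 (real n) > 0" using assms by simp
    ultimately show ?thesis by (simp add: pos_divide_le_eq)
  qed
  consider "n = 2" | "2 < n" "n \<le> 4" | "4 < n" "n \<le> 8" | "8 < n" "n \<le> 16" | "16 < n" "n \<le> 32"
    | "32 < n" "n \<le> 60" using assms by linarith
  then show ?thesis
  proof cases
    case 1
    then have "b \<noteq> 0" using assms(3) by (cases b) auto
    with 1 show ?thesis by simp
  next
    case 2 then show ?thesis by (intro *[of 1]) auto
  next
    case 3 then show ?thesis by (intro *[of 2]) auto
  next
    case 4 then show ?thesis by (intro *[of 3]) auto
  next
    case 5 then show ?thesis by (intro *[of 4]) auto
  next
    case 6 then show ?thesis by (intro *[of 5]) auto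
  qed
qed

lemma large_cluster_bound:
  assumes n: "n > 60"
  shows "\<exists>m K. 3 * m \<le> n \<and> m \<le> 2 ^ K \<and>
    (\<forall>b. 2 * m \<le> b * (K + 2) \<longrightarrow> real n / (2 * log 2 (real n)) \<le> real b)"
proof -
  define L where "L = log 2 (real n)"
  define m where "m = n div 3"
  define K where "K = nat \<lceil>log 2 (real m)\<rceil>"
  have m: "real m \<ge> 20" "3 * m \<le> n" "real m \<ge> (real n - 2) / 3"
  proof -
    have "20 \<le> m" "3 * m \<le> n" "n \<le> 3 * m + 2" using n unfolding m_def by presburger+
    then show "real m \<ge> 20" "3 * m \<le> n" by linarith+
    have "real n \<le> real (3 * m + 2)" using \<open>n \<le> 3 * m + 2\<close> by (rule of_nat_mono)
    then show "real m \<ge> (real n - 2) / 3" by simp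
  qed
  have lm: "0 \<le> log 2 (real m)" using m(1) by simp
  then have K: "log 2 (real m) \<le> real K" "real K \<le> log 2 (real m) + 1"
    unfolding K_def by linarith+
  have "real m = 2 powr log 2 (real m)" using m(1) by simp
  also have "\<dots> \<le> 2 powr real K" using K(1) by simp
  also have "\<dots> = real (2 ^ K)" by (simp add: powr_realpow)
  finally have mK: "m \<le> 2 ^ K" by (simp only: of_nat_le_iff)
  \<comment> \<open>As 2048 is at most 3600, twice the logarithm of \<open>n\<close> is at least
    11.\<close>
  have "(2::real) ^ 11 \<le> 60 ^ 2" by simp
  also have "\<dots> \<le> real n ^ 2" using n by (intro power_mono) auto
  finally have "real 11 \<le> log 2 (real n ^ 2)" by (intro le_log_of_power) auto
  then have L: "11 / 2 \<le> L" using n by (simp add: log_nat_power L_def)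
  \<comment> \<open>From \<open>8 * m ^ 2 \<le> (3 * m) ^ 2 \<le> n ^ 2\<close> the logarithm of
    \<open>m\<close> is at most \<open>L - 3 / 2\<close>. Rounding up costs at most 1, whence
    \<open>K + 2 \<le> L + 3 / 2\<close>.\<close>
  have "log 2 ((real m) ^ 2 * 2 ^ 3) \<le> log 2 (real n ^ 2)"
  proof (subst log_le_cancel_iff)
    have "(3 * real m) ^ 2 \<le> real n ^ 2" using m(2) by (intro power_mono) auto
    moreover have "(real m) ^ 2 * 2 ^ 3 \<le> (3 * real m) ^ 2" by (simp add: power_mult_distrib)
    ultimately show "(real m) ^ 2 * 2 ^ 3 \<le> real n ^ 2" by linarith
  qed (use n m in auto)
  moreover have "log 2 ((real m) ^ 2 * 2 ^ 3) = 2 * log 2 (real m) + 3"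
    using m(1) by (simp add: log_mult log_nat_power log_pow_cancel[of 2 3, simplified])
  ultimately have "2 * log 2 (real m) + 3 \<le> 2 * L"
    using n by (simp add: log_nat_power L_def)
  then have KL: "real K + 2 \<le> L + 3 / 2" using K(2) by simp
  have "real n / (2 * L) \<le> real b" if b: "2 * m \<le> b * (K + 2)" for b
  proof -
    \<comment> \<open>The next inequality is equivalent to
      \<open>(n - 8) * (L - 9 / 2) \<ge> 36\<close>, and here \<open>n - 8\<close> exceeds 52 while
      \<open>L - 9 / 2\<close> is at least 1.\<close>
    have "(real n - 8) * 1 \<le> (real n - 8) * (L - 9 / 2)" using n L by (intro mult_left_mono) auto
    then have "real n * (L + 3 / 2) \<le> 4 * ((real n - 2) / 3) * L" using n by (simp add: field_simps)
    also have "\<dots> \<le> 4 * real m * L" using m(3) L by (intro mult_right_mono) auto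
    also have "\<dots> = 2 * real (2 * m) * L" by simp
    also have "\<dots> \<le> 2 * real (b * (K + 2)) * L" using b L by (intro mult_right_mono mult_left_mono of_nat_mono) auto
    also have "\<dots> = (2 * real b * L) * (real K + 2)" by (simp add: algebra_simps)
    also have "\<dots> \<le> (2 * real b * L) * (L + 3 / 2)" using KL L by (intro mult_left_mono) auto
    finally have "real n \<le> 2 * real b * L" using L by (simp add: mult_le_cancel_right)
    then show ?thesis using L by (simp add: field_simps)
  qed
  then show ?thesis using m(2) mK unfolding L_def by blast
qed

lemma max_sep_num_gp_lower:
  assumes n: "n \<ge> 2"
  shows "ereal (real n / (2 * log 2 (real n))) \<le> ereal_of_enat (max_sep_num_gp n planar_convex_sets)"
proof (cases "n \<le> 60")
  case True
  \<comment> \<open>With no clusters at all, this just supplies \<open>n\<close> points in general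
    position.\<close>
  obtain X :: "(real ^ 2) set" where X: "finite X" "card X = n" "general_position X"
    using clustered_set[of 0 n 0] by auto
  show ?thesis
  proof (rule max_sep_num_gp_ge[OF X])
    fix F :: "(real ^ 2) set set"
    assume "finite F" "\<And>x y. x \<in> X \<Longrightarrow> y \<in> X \<Longrightarrow> x \<noteq> y \<Longrightarrow> \<exists>A\<in>F. separates A x y"
    then have "n \<le> 2 ^ card F" using card_le_power_separating X(2) by metis
    then show "real n / (2 * log 2 (real n)) \<le> real (card F)" using small_log_bound n True by blast
  qed
next
  case False
  then obtain m K where mK: "3 * m \<le> n" "m \<le> 2 ^ K"
    and v: "\<And>b. 2 * m \<le> b * (K + 2) \<Longrightarrow> real n / (2 * log 2 (real n)) \<le> real b"
    using large_cluster_bound[of n] by auto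
  obtain X where X: "finite X" "card X = n" "general_position X"
    and F: "\<And>F. finite F \<Longrightarrow> (\<And>A. A \<in> F \<Longrightarrow> convex A) \<Longrightarrow>
      (\<And>x y. x \<in> X \<Longrightarrow> y \<in> X \<Longrightarrow> x \<noteq> y \<Longrightarrow> \<exists>A\<in>F. separates A x y) \<Longrightarrow> 2 * m \<le> card F * (K + 2)"
    using clustered_set[OF mK] by blast
  show ?thesis by (rule max_sep_num_gp_ge[OF X]) (rule v, rule F)
qed

theorem theorem2:
  fixes n :: nat
  assumes "n \<ge> 2"
  shows "max_sep_num n planar_convex_sets = enat (nat \<lceil>real n / 2\<rceil>) \<and>
         ereal (real n / (2 * log 2 (real n)))
           \<le> ereal_of_enat (max_sep_num_gp n planar_convex_sets) \<and>
         (n \<ge> 3 \<longrightarrow>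
           ereal_of_enat (max_sep_num_gp n planar_convex_sets)
             \<le> ereal (20 * real n * log 2 (log 2 (real n)) / log 2 (real n)))"
  using max_sep_num_eq[OF assms] nat_ceiling_half max_sep_num_gp_lower[OF assms] max_sep_num_gp_upper
  by simp

end
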